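(* Let $u$ be a subharmonic function in $\mathbb{D}$ that is bounded from above, let $\gamma\in(0,1]$ and $p\in(1,\infty)$, and let $\lambda=\lambda_u$ be the complete measure of $u$. Then $$m_p(r,u)=O\bigl((1-r)^{\gamma-1}\bigr),\quad r\uparrow 1,$$ holds if and only if $$\Bigl(\int_0^{2\pi}\lambda^p(\mathcal{C}(\varphi,\delta))\,d\varphi\Bigr)^{1/p}=O(\delta^\gamma),\quad 0<\delta<1.$$
   Context: $\mathbb{D}=\{z\in\mathbb{C}:|z|<1\}$. Subharmonic functions are understood to be not identically $-\infty$. For $u$ subharmonic in $\mathbb{D}$ and $p\ge 1$, $m_p(r,u)=\bigl(\frac1{2\pi}\int_0^{2\pi}|u(re^{i\theta})|^p\,d\theta\bigr)^{1/p}$, $0<r<1$. Complete measure. Every subharmonic function $u$ in $\mathbb{D}$ bounded from above has a representation $$u(z)=\int_{\mathbb{D}}\log\frac{|z-\zeta|}{|1-z\bar\zeta|}\,d\mu_u(\zeta)-\frac1{2\pi}\int_{\partial\mathbb{D}}\frac{1-|z|^2}{|\zeta-z|^2}\,d\psi(\zeta)+C,$$ where $\mu_u$ is the Riesz measure of $u$ (normalized so that for $u=\log|f|$, $f$ analytic, it is the counting measure of the zeros of $f$ with multiplicity), $\int_{\mathbb{D}}(1-|\zeta|)\,d\mu_u(\zeta)<\infty$, $\psi$ is a finite positive Borel measure on $\partial\mathbb{D}$, and $C$ is a real constant. The complete measure of $u$ (in the sense of Grishin) is the finite positive measure on $\overline{\mathbb{D}}$ given, for such a representation, by $$\lambda_u(M)=\int_{\mathbb{D}\cap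 M}(1-|\zeta|)\,d\mu_u(\zeta)+\psi(M\cap\partial\mathbb{D})$$ for Borel $M\subset\overline{\mathbb{D}}$. Carleson box: $\mathcal{C}(\varphi,\delta)=\{\zeta\in\overline{\mathbb{D}}:|\zeta|\ge 1-\delta,\ |\arg\zeta-\varphi|\le\pi\delta\}$, with the difference of arguments understood modulo $2\pi$. $\lambda^p(E)$ means $(\lambda(E))^p$. *)

theory Defs
  imports "HOL-Analysis.Analysis"
begin

text \<open>Extended-real integral: \<open>\<integral>f\<^sup>+ - \<integral>f\<^sup>-\<close>. Note that \<^const>\<open>e2ennreal\<close> sends negative arguments to 0.
  It is only used where at least one of the two parts is finite.\<close>

definition ereal_integral :: "'a measure \<Rightarrow> ('a \<Rightarrow> ereal) \<Rightarrow> ereal" where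
  "ereal_integral M f =
     enn2ereal (\<integral>\<^sup>+ x. e2ennreal (f x) \<partial>M) - enn2ereal (\<integral>\<^sup>+ x. e2ennreal (- f x) \<partial>M)"

text \<open>Logarithm with value \<open>-\<infinity>\<close> at 0 (whereas \<^term>\<open>ln (0::real) = 0\<close>).\<close>

definition elog :: "real \<Rightarrow> ereal" where
  "elog x = (if x \<le> 0 then -\<infinity> else ereal (ln x))"

definition ennreal_powr :: "ennreal \<Rightarrow> real \<Rightarrow> ennreal" where
  "ennreal_powr a p = (if a = \<infinity> then \<infinity> else ennreal (enn2real a powr p))"

definition circle_mean :: "(complex \<Rightarrow> ereal) \<Rightarrow> complex \<Rightarrow> real \<Rightarrow> ereal" where
  "circle_mean u z r =
     ereal_integral (restrict_space lborel {0..2*pi}) (\<lambda>t. u (z + of_real r * cis t)) / ereal (2*pi)"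

definition usc_on :: "complex set \<Rightarrow> (complex \<Rightarrow> ereal) \<Rightarrow> bool" where
  "usc_on S u \<longleftrightarrow> (\<forall>z\<in>S. \<forall>a. u z < a \<longrightarrow> (\<forall>\<^sub>F w in at z within S. u w < a))"

text \<open>Intended for open connected \<open>S\<close>; the last conjunct excludes \<open>u \<equiv> -\<infinity>\<close>.\<close>

definition subharmonic_on :: "complex set \<Rightarrow> (complex \<Rightarrow> ereal) \<Rightarrow> bool" where
  "subharmonic_on S u \<longleftrightarrow>
     (\<forall>z\<in>S. u z \<noteq> \<infinity>) \<and> usc_on S u \<and>
     (\<forall>z r. 0 < r \<and> cball z r \<subseteq> S \<longrightarrow> u z \<le> circle_mean u z r) \<and>
     (\<exists>z\<in>S. u z \<noteq> -\<infinity>)"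

primrec Ck :: "nat \<Rightarrow> (complex \<Rightarrow> real) \<Rightarrow> bool" where
  "Ck 0 f \<longleftrightarrow> continuous_on UNIV f"
| "Ck (Suc n) f \<longleftrightarrow>
     (\<forall>z. f differentiable at z) \<and> (\<forall>v. Ck n (\<lambda>z. frechet_derivative f (at z) v))"

definition test_function :: "complex set \<Rightarrow> (complex \<Rightarrow> real) \<Rightarrow> bool" where
  "test_function S f \<longleftrightarrow>
     (\<forall>n. Ck n f) \<and> compact (closure {z. f z \<noteq> 0}) \<and> closure {z. f z \<noteq> 0} \<subseteq> S"

definition laplacian :: "(complex \<Rightarrow> real) \<Rightarrow> complex \<Rightarrow> real" where
  "laplacian f z =
     frechet_derivative (\<lambda>w. frechet_derivative f (at w) 1) (at z) 1 +
     frechet_derivative (\<lambda>w. frechet_derivative f (at w) \<i>) (at z) \<i>"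

text \<open>The Riesz measure is \<open>1/(2\<pi>)\<close> times the distributional Laplacian; this is the normalization
  for which \<open>log |f|\<close> yields the zero-counting measure of \<open>f\<close>. A subharmonic function is locally
  integrable and takes the value \<open>-\<infinity>\<close> only on a Lebesgue null set, so \<^const>\<open>real_of_ereal\<close> is
  harmless under the integral.\<close>

definition is_riesz_measure :: "complex set \<Rightarrow> (complex \<Rightarrow> ereal) \<Rightarrow> complex measure \<Rightarrow> bool" where
  "is_riesz_measure S u \<mu> \<longleftrightarrow>
     sets \<mu> = sets (restrict_space borel S) \<and>
     (\<forall>K. compact K \<and> K \<subseteq> S \<longrightarrow> emeasure \<mu> K < \<infinity>) \<and>
     (\<forall>f. test_function S f \<longrightarrow>
        (LINT z:S|lborel. real_of_ereal (u z) * laplacian f z) = 2 * pi * (LINT z|\<mu>. f z))"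

definition riesz_representation ::
    "(complex \<Rightarrow> ereal) \<Rightarrow> complex measure \<Rightarrow> complex measure \<Rightarrow> real \<Rightarrow> bool" where
  "riesz_representation u \<mu> \<psi> C \<longleftrightarrow>
     is_riesz_measure (ball 0 1) u \<mu> \<and>
     (\<integral>\<^sup>+ \<zeta>. ennreal (1 - norm \<zeta>) \<partial>\<mu>) < \<infinity> \<and>
     sets \<psi> = sets (restrict_space borel (sphere 0 1)) \<and> finite_measure \<psi> \<and>
     (\<forall>z\<in>ball 0 1. u z =
        ereal_integral \<mu> (\<lambda>\<zeta>. elog (norm (z - \<zeta>) / norm (1 - z * cnj \<zeta>)))
        - ereal (1 / (2*pi) * (LINT \<zeta>|\<psi>. (1 - (norm z)\<^sup>2) / (norm (\<zeta> - z))\<^sup>2))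
        + ereal C)"

text \<open>A relation rather than a function of \<open>u\<close>: adding a multiple of arc length to \<open>\<psi>\<close> can be
  compensated by the constant \<open>C\<close>, so \<open>u\<close> alone does not determine \<open>\<psi>\<close>, and there is one complete
  measure for each representation.\<close>

definition is_complete_measure :: "(complex \<Rightarrow> ereal) \<Rightarrow> complex measure \<Rightarrow> bool" where
  "is_complete_measure u L \<longleftrightarrow>
     sets L = sets (restrict_space borel (cball 0 1)) \<and>
     (\<exists>\<mu> \<psi> C. riesz_representation u \<mu> \<psi> C \<and>
        (\<forall>M\<in>sets L. emeasure L M =
           (\<integral>\<^sup>+ \<zeta>\<in>ball 0 1 \<inter> M. ennreal (1 - norm \<zeta>) \<partial>\<mu>) + emeasure \<psi> (M \<inter> sphere 0 1)))"

definition carleson_box :: "real \<Rightarrow> real \<Rightarrow> complex set" where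
  "carleson_box \<phi> \<delta> =
     {\<zeta> \<in> cball 0 1. norm \<zeta> \<ge> 1 - \<delta> \<and> (\<exists>k::int. \<bar>Arg \<zeta> - \<phi> + 2 * pi * of_int k\<bar> \<le> pi * \<delta>)}"

definition p_mean :: "real \<Rightarrow> real \<Rightarrow> (complex \<Rightarrow> ereal) \<Rightarrow> ennreal" where
  "p_mean p r u = ennreal_powr
     (ennreal (1 / (2*pi)) *
       (\<integral>\<^sup>+ t\<in>{0..2*pi}. ennreal_powr (e2ennreal \<bar>u (of_real r * cis t)\<bar>) p \<partial>lborel)) (1/p)"

definition carleson_norm :: "real \<Rightarrow> complex measure \<Rightarrow> real \<Rightarrow> ennreal" where
  "carleson_norm p L \<delta> = ennreal_powr
     (\<integral>\<^sup>+ \<phi>\<in>{0..2*pi}. ennreal_powr (emeasure L (carleson_box \<phi> \<delta>)) p \<partial>lborel) (1/p)"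

end

theory Submission
  imports Defs
begin

text \<open>The representation of \<^term>\<open>u\<close> says that \<open>u = C - V\<close> on the disc, where \<open>V\<close> is the integral of a
positive kernel \<open>K(z, \<zeta>)\<close> against the complete measure \<open>\<lambda>\<close>: inside the disc \<open>K\<close> is the Green function
divided by \<open>1 - |\<zeta>|\<close>, and on the circle it is the Poisson kernel over \<open>2\<pi>\<close>
(\<open>complete_measure_potential\<close>). Since \<open>\<gamma> \<le> 1\<close>, the bound \<open>(1 - r)\<close> to the power \<open>\<gamma> - 1\<close> does not
tend to 0, so the constant \<open>C\<close> is absorbed, and only the two families of integrals
\<open>\<integral> V((1 - \<delta>) e\<^sup>i\<^sup>\<phi>)\<^sup>p d\<phi>\<close> and \<open>\<integral> \<lambda>(C(\<phi>, \<delta>))\<^sup>p d\<phi>\<close> have to be compared.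

Boxes are controlled by the potential because \<open>K(z, \<zeta>)\<close> is at least a multiple of
\<open>(1 - |z|) / |1 - z cnj \<zeta>|\<^sup>2\<close>, hence of \<open>1 / \<delta>\<close>, when \<open>z = (1 - \<delta>) e\<^sup>i\<^sup>\<phi>\<close> and \<open>\<zeta>\<close> lies in \<open>C(\<phi>, \<delta>)\<close>
(\<open>emeasure_carleson_box_le_potential\<close>).

Conversely, split \<open>V(z)\<close> at the distance \<open>\<delta> / 2\<close> from \<open>z\<close>. Far from \<open>z\<close> the kernel is at most
\<open>2 \<delta> / |z - \<zeta>|\<^sup>2\<close>, so this part is dominated by a constant times the sum of the terms
\<open>4\<^sup>-\<^sup>k \<lambda>(C(\<phi>, 2\<^sup>k\<^sup>+\<^sup>1 \<delta>)) / \<delta>\<close>, whose mean is controlled by Jensen's inequality for sums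
(\<open>far_sum_energy\<close>). Near \<open>z\<close> the kernel has a logarithmic singularity. Its \<open>p\<close>-th power is still
integrable along the circle, uniformly in \<open>\<zeta>\<close> after scaling (\<open>nn_integral_near_disc_kernel_powr_le\<close>).
Jensen's inequality on the box \<open>C(\<phi>, 2\<delta>)\<close> produces the factor \<open>\<lambda>(C(\<phi>, 2\<delta>))\<^sup>p\<^sup>-\<^sup>1\<close>; it is replaced by the
measure of a box centred at the argument of \<open>\<zeta>\<close>, which makes the integration over \<open>\<phi>\<close> possible, and
the remaining integral over \<open>\<zeta>\<close> is converted back to a mean over boxes by Fubini's theorem, because
every \<open>\<zeta>\<close> near the circle lies in the boxes of a whole interval of angles (\<open>near_energy\<close>).\<close>

section \<open>Powers of extended nonnegative reals and Jensen's inequality\<close>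

lemma ennreal_powr_ennreal: "0 \<le> x \<Longrightarrow> ennreal_powr (ennreal x) p = ennreal (x powr p)"
  by (simp add: ennreal_powr_def)

lemma ennreal_powr_top [simp]: "ennreal_powr top p = top"
  by (simp add: ennreal_powr_def)

lemma ennreal_powr_0 [simp]: "ennreal_powr 0 p = 0"
  by (simp add: ennreal_powr_def)

lemma ennreal_powr_mono: "a \<le> b \<Longrightarrow> 0 \<le> p \<Longrightarrow> ennreal_powr a p \<le> ennreal_powr b p"
  by (cases a; cases b) (auto simp: ennreal_powr_ennreal powr_mono2 top_unique)

lemma ennreal_powr_mult:
  "0 < p \<Longrightarrow> ennreal_powr (a * b) p = ennreal_powr a p * ennreal_powr b p"
proof -
  assume p: "0 < p"
  have *: "ennreal_powr (top * ennreal x) p = top * ennreal_powr (ennreal x) p" if "0 \<le> x" for x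
    using p that by (cases "x = 0") (auto simp: ennreal_powr_ennreal ennreal_top_mult)
  show ?thesis
    using p *
    by (cases a; cases b)
       (auto simp: ennreal_powr_ennreal powr_mult ennreal_top_mult mult.commute
             simp flip: ennreal_mult)
qed

lemma ennreal_powr_powr: "ennreal_powr (ennreal_powr a p) q = ennreal_powr a (p * q)"
  by (cases a) (auto simp: ennreal_powr_ennreal powr_powr)

lemma ennreal_powr_one [simp]: "ennreal_powr a 1 = a"
  by (cases a) (auto simp: ennreal_powr_ennreal)

lemma ennreal_powr_minus_one_mult:
  "0 < p \<Longrightarrow> ennreal_powr a (p - 1) * a = ennreal_powr a p"
proof (cases a)
  case (real x)
  assume "0 < p"
  with real show ?thesis
    by (cases "x = 0") (auto simp: ennreal_powr_ennreal powr_diff simp flip: ennreal_mult)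
qed (auto simp: ennreal_top_mult)

lemma borel_measurable_ennreal_powr [measurable (raw)]:
  assumes [measurable]: "f \<in> borel_measurable M"
  shows "(\<lambda>x. ennreal_powr (f x) p) \<in> borel_measurable M"
  unfolding ennreal_powr_def by measurable

lemma ennreal_powr_add_le:
  assumes "0 \<le> p"
  shows "ennreal_powr (a + b) p \<le> ennreal (2 powr p) * (ennreal_powr a p + ennreal_powr b p)"
proof (cases "a = top \<or> b = top")
  case True
  then show ?thesis by (auto simp: ennreal_mult_top)
next
  case False
  then obtain x y where xy: "0 \<le> x" "0 \<le> y" "a = ennreal x" "b = ennreal y"
    by (metis ennreal_cases)
  have "(x + y) powr p \<le> (2 * max x y) powr p"
    using xy assms by (intro powr_mono2) auto
  also have "\<dots> = 2 powr p * (max x y powr p)"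
    using xy by (simp add: powr_mult)
  also have "\<dots> \<le> 2 powr p * (x powr p + y powr p)"
    by (intro mult_left_mono) (auto simp: max_def)
  finally have "ennreal ((x + y) powr p) \<le> ennreal (2 powr p * (x powr p + y powr p))"
    by (rule ennreal_leI)
  then show ?thesis
    using xy by (simp add: ennreal_powr_ennreal ennreal_mult flip: ennreal_plus)
qed

lemma ennreal_powr_inverse_le_iff:
  assumes "0 < p" "0 \<le> y"
  shows "ennreal_powr a (1 / p) \<le> ennreal y \<longleftrightarrow> a \<le> ennreal (y powr p)"
proof
  assume "ennreal_powr a (1 / p) \<le> ennreal y"
  then have "ennreal_powr (ennreal_powr a (1 / p)) p \<le> ennreal_powr (ennreal y) p"
    using assms by (intro ennreal_powr_mono) auto
  then show "a \<le> ennreal (y powr p)"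
    using assms by (simp add: ennreal_powr_powr ennreal_powr_ennreal)
next
  assume "a \<le> ennreal (y powr p)"
  then have "ennreal_powr a (1 / p) \<le> ennreal_powr (ennreal (y powr p)) (1 / p)"
    using assms by (intro ennreal_powr_mono) auto
  also have "\<dots> = ennreal y"
    using assms by (simp add: ennreal_powr_ennreal powr_powr)
  finally show "ennreal_powr a (1 / p) \<le> ennreal y" .
qed

text \<open>Convexity of \<open>x\<^sup>p\<close> in the form of its supporting line at \<open>m\<close>, rearranged so that no subtraction
occurs; in this shape it carries over to extended nonnegative reals.\<close>

lemma powr_tangent_le:
  fixes x m p :: real
  assumes "0 \<le> x" "0 < m" "1 < p"
  shows "p * m powr (p - 1) * x \<le> x powr p + (p - 1) * m powr p"
proof -
  have "x * m powr (p - 1) \<le> x powr p / p + (m powr (p - 1)) powr (p / (p - 1)) / (p / (p - 1))"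
    using assms by (intro Youngs_inequality) (auto simp: field_simps)
  also have "(m powr (p - 1)) powr (p / (p - 1)) = m powr p"
    using assms by (simp add: powr_powr)
  finally show ?thesis
    using assms by (simp add: field_simps)
qed

lemma ennreal_powr_tangent_le:
  assumes "0 < m" "1 < p"
  shows "ennreal (p * m powr (p - 1)) * a \<le> ennreal_powr a p + ennreal ((p - 1) * m powr p)"
proof (cases a)
  case (real x)
  have "ennreal (p * m powr (p - 1) * x) \<le> ennreal (x powr p + (p - 1) * m powr p)"
    using powr_tangent_le[of x m p] real assms by (intro ennreal_leI) auto
  then show ?thesis
    using real assms by (simp add: ennreal_powr_ennreal ennreal_mult' ennreal_plus)
qed simp

text \<open>Jensen's inequality for the finite measure with density \<open>w\<close>, with the normalisation multiplied out.
Integrating the tangent inequality at the point \<open>m\<close>, and choosing \<open>m\<close> as the \<open>w\<close>-average of \<open>f\<close>, gives the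
claim. Two instances matter below: \<open>w\<close> the indicator of a box, and \<open>w\<close> a summable sequence on the
counting measure.\<close>

lemma nn_integral_powr_Jensen:
  assumes [measurable]: "w \<in> borel_measurable M" "f \<in> borel_measurable M"
    and p: "1 < p"
    and fin: "(\<integral>\<^sup>+x. w x \<partial>M) < \<infinity>"
  shows "ennreal_powr (\<integral>\<^sup>+x. w x * f x \<partial>M) p
    \<le> ennreal_powr (\<integral>\<^sup>+x. w x \<partial>M) (p - 1) * (\<integral>\<^sup>+x. w x * ennreal_powr (f x) p \<partial>M)"
proof -
  define N where "N = enn2real (\<integral>\<^sup>+x. w x \<partial>M)"
  have N: "(\<integral>\<^sup>+x. w x \<partial>M) = ennreal N" "0 \<le> N"
    using fin by (auto simp: N_def)
  define F where "F = (\<integral>\<^sup>+x. w x * f x \<partial>M)"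
  define G where "G = (\<integral>\<^sup>+x. w x * ennreal_powr (f x) p \<partial>M)"
  have tangent: "ennreal (p * m powr (p - 1)) * F \<le> G + ennreal ((p - 1) * m powr p) * ennreal N"
    if m: "0 < m" for m
  proof -
    have "ennreal (p * m powr (p - 1)) * F
        = (\<integral>\<^sup>+x. w x * (ennreal (p * m powr (p - 1)) * f x) \<partial>M)"
      unfolding F_def by (subst nn_integral_cmult[symmetric]) (auto simp: mult_ac)
    also have "\<dots> \<le> (\<integral>\<^sup>+x. w x * (ennreal_powr (f x) p + ennreal ((p - 1) * m powr p)) \<partial>M)"
      by (intro nn_integral_mono mult_left_mono ennreal_powr_tangent_le m p) auto
    also have "\<dots> = G + (\<integral>\<^sup>+x. ennreal ((p - 1) * m powr p) * w x \<partial>M)"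
      unfolding G_def by (subst nn_integral_add[symmetric]) (auto simp: distrib_left mult_ac)
    also have "\<dots> = G + ennreal ((p - 1) * m powr p) * ennreal N"
      by (simp add: nn_integral_cmult N)
    finally show ?thesis .
  qed
  show ?thesis
  proof (cases "N = 0")
    case True
    then have "AE x in M. w x = 0"
      using N by (simp add: nn_integral_0_iff_AE)
    then have "F = 0"
      unfolding F_def by (subst nn_integral_0_iff_AE) auto
    then show ?thesis by (simp add: F_def)
  next
    case False
    then have N0: "0 < N" using N by simp
    show ?thesis
    proof (cases F)
      case top
      have "top \<le> G + ennreal (p - 1) * ennreal N"
        using tangent[of 1] p top by (simp add: ennreal_mult_top)
      then have "G = top"
        by (simp add: top_unique ennreal_mult_eq_top_iff)
      then show ?thesis
        using N0 N by (simp add: ennreal_powr_ennreal ennreal_mult_top flip: G_def)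
    next
      case (real y)
      show ?thesis
      proof (cases "y = 0 \<or> G = top")
        case True
        then show ?thesis
          using real N N0 
          by (auto simp: ennreal_powr_ennreal ennreal_mult_top  simp flip: F_def G_def)
      next
        case False
        then obtain g where g: "0 \<le> g" "G = ennreal g" by (metis ennreal_cases)
        \<comment> \<open>The best supporting line is the one at the weighted average of \<open>f\<close>.\<close>
        define m where "m = y / N"
        have m: "0 < m" using False N0 real by (auto simp: m_def)
        have "ennreal (p * m powr (p - 1) * y) \<le> ennreal (g + (p - 1) * m powr p * N)"
          using tangent[OF m] g real N p by (simp add: ennreal_mult' ennreal_plus)
        then have "p * m powr (p - 1) * y \<le> g + (p - 1) * m powr p * N"
          using g N p by (subst (asm) ennreal_le_iff) auto
        moreover have "m powr p * N = m powr (p - 1) * y"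
          using m N0 by (simp add: powr_diff) (simp add: m_def)
        ultimately have *: "p * (m powr (p - 1) * y) \<le> g + (p - 1) * (m powr (p - 1) * y)"
          by (metis mult.assoc)
        have "m powr (p - 1) * y \<le> g"
          using * by (simp only: left_diff_distrib mult_1_left)
        have "y powr p = y powr (p - 1) * y"
          using False real by (simp add: powr_diff)
        also have "y = N * m"
          using N0 by (simp add: m_def)
        also have "(N * m) powr (p - 1) * (N * m) = N powr (p - 1) * (m powr (p - 1) * (N * m))"
          using N0 m by (simp only: powr_mult mult.assoc)
        also have "N * m = y"
          using N0 by (simp add: m_def)
        also have "N powr (p - 1) * (m powr (p - 1) * y) \<le> N powr (p - 1) * g"
          using \<open>m powr (p - 1) * y \<le> g\<close> by (intro mult_left_mono) auto
        finally have "y powr p \<le> N powr (p - 1) * g" .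
        then show ?thesis
          using g real N p
          by (simp add: ennreal_powr_ennreal ennreal_leI flip: F_def G_def ennreal_mult)
      qed
    qed
  qed
qed

section \<open>The kernel of the Riesz representation\<close>

text \<open>The kernel of the potential with respect to the complete measure: the factor \<open>1 - |\<zeta>|\<close> of the
complete measure is divided out of the Green function. On the circle the value is the Poisson kernel as it
enters the representation, which is \<open>1 / (2\<pi>)\<close> times the limit of the interior values. Outside the
closed disc there is no mass, and 0 is a default that keeps the kernel Borel on the whole plane.\<close>

definition disc_kernel :: "complex \<Rightarrow> complex \<Rightarrow> ennreal" where
  "disc_kernel z \<zeta> =
     (if norm \<zeta> < 1 then e2ennreal (- elog (norm (z - \<zeta>) / norm (1 - z * cnj \<zeta>))) / ennreal (1 - norm \<zeta>)
      else if norm \<zeta> = 1 then ennreal ((1 - (norm z)\<^sup>2) / (2 * pi * (norm (\<zeta> - z))\<^sup>2))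
      else 0)"

text \<open>This identity turns the pseudohyperbolic distance into
\<open>1 - (1 - |z|\<^sup>2) (1 - |\<zeta>|\<^sup>2) / |1 - z cnj \<zeta>|\<^sup>2\<close>, and all estimates of the Green function rest on it.\<close>

lemma norm_one_minus_mult_cnj_sq:
  "(norm (1 - z * cnj \<zeta>))\<^sup>2 = (norm (z - \<zeta>))\<^sup>2 + (1 - (norm z)\<^sup>2) * (1 - (norm \<zeta>)\<^sup>2)"
  by (simp only: cmod_power2) (simp add: algebra_simps power2_eq_square)

lemma one_minus_mult_cnj_nonzero:
  assumes "norm z < 1" "norm \<zeta> \<le> 1"
  shows "0 < norm (1 - z * cnj \<zeta>)"
proof -
  have "norm (z * cnj \<zeta>) \<le> norm z"
    using assms by (simp add: norm_mult mult_left_le)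
  then have "z * cnj \<zeta> \<noteq> 1"
    using assms by (metis norm_one not_less order.trans)
  then show ?thesis by simp
qed

lemma e2ennreal_minus_elog: "0 < x \<Longrightarrow> e2ennreal (- elog x) = ennreal (- ln x)"
  by (simp add: elog_def)

lemma disc_kernel_interior:
  assumes "norm z < 1" "norm \<zeta> < 1" "z \<noteq> \<zeta>"
  shows "disc_kernel z \<zeta> = ennreal (ln (norm (1 - z * cnj \<zeta>) / norm (z - \<zeta>)) / (1 - norm \<zeta>))"
proof -
  have *: "0 < norm (1 - z * cnj \<zeta>)"
    using assms by (intro one_minus_mult_cnj_nonzero) auto
  then have "0 < norm (z - \<zeta>) / norm (1 - z * cnj \<zeta>)"
    using assms by simp
  moreover have "- ln (norm (z - \<zeta>) / norm (1 - z * cnj \<zeta>)) = ln (norm (1 - z * cnj \<zeta>) / norm (z - \<zeta>))"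
    using assms * by (simp add: ln_div)
  moreover have "0 \<le> ln (norm (1 - z * cnj \<zeta>) / norm (z - \<zeta>))"
  proof -
    have "(norm (z - \<zeta>))\<^sup>2 \<le> (norm (1 - z * cnj \<zeta>))\<^sup>2"
      using assms by (subst norm_one_minus_mult_cnj_sq) (auto simp: abs_square_le_1)
    then have "norm (z - \<zeta>) \<le> norm (1 - z * cnj \<zeta>)"
      by (simp add: power2_le_iff_abs_le)
    then show ?thesis using assms by simp
  qed
  ultimately show ?thesis
    using assms by (simp add: disc_kernel_def e2ennreal_minus_elog divide_ennreal)
qed

lemma disc_kernel_diagonal: "norm z < 1 \<Longrightarrow> disc_kernel z z = top"
  by (simp add: disc_kernel_def elog_def ennreal_top_divide)

text \<open>Twice the Green function is \<open>ln (a\<^sup>2 / d\<^sup>2)\<close> with \<open>a = |1 - z cnj \<zeta>|\<close> and \<open>d = |z - \<zeta>|\<close>; the bound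
\<open>ln x \<le> x - 1\<close> and the identity for \<open>a\<^sup>2 - d\<^sup>2\<close> produce the factor \<open>1 - |\<zeta>|\<close> that the kernel divides out.\<close>

lemma disc_kernel_le:
  assumes z: "norm z < 1" and ne: "z \<noteq> \<zeta>"
  shows "disc_kernel z \<zeta> \<le> ennreal (2 * (1 - norm z) / (norm (z - \<zeta>))\<^sup>2)"
proof -
  consider "norm \<zeta> < 1" | "norm \<zeta> = 1" | "norm \<zeta> > 1" by linarith
  then show ?thesis
  proof cases
    case 1
    define a where "a = norm (1 - z * cnj \<zeta>)"
    define d where "d = norm (z - \<zeta>)"
    have a: "0 < a" unfolding a_def using z 1 by (intro one_minus_mult_cnj_nonzero) auto
    have d: "0 < d" using ne by (simp add: d_def)
    have "2 * ln (a / d) = ln ((a / d)\<^sup>2)"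
      using a d by (simp add: ln_realpow)
    also have "\<dots> \<le> (a / d)\<^sup>2 - 1"
      using a d by (intro ln_le_minus_one) auto
    also have "\<dots> = (1 - (norm z)\<^sup>2) * (1 - (norm \<zeta>)\<^sup>2) / d\<^sup>2"
      using d norm_one_minus_mult_cnj_sq[of z \<zeta>]
      by (simp add: power_divide field_simps flip: a_def d_def)
    also have "\<dots> = (1 - norm z) * (1 + norm z) * ((1 + norm \<zeta>) * (1 - norm \<zeta>)) / d\<^sup>2"
      by (simp add: power2_eq_square algebra_simps)
    also have "\<dots> \<le> (1 - norm z) * 2 * (2 * (1 - norm \<zeta>)) / d\<^sup>2"
      using z 1 by (intro divide_right_mono mult_mono mult_left_mono mult_right_mono) auto
    finally have "ln (a / d) / (1 - norm \<zeta>) \<le> 2 * (1 - norm z) / d\<^sup>2"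
      using 1 d by (simp add: field_simps)
    then show ?thesis
      unfolding disc_kernel_interior[OF z 1 ne] a_def d_def by (rule ennreal_leI)
  next
    case 2
    have d: "0 < norm (z - \<zeta>)" using ne by simp
    have "1 - (norm z)\<^sup>2 = (1 - norm z) * (1 + norm z)"
      by (simp add: power2_eq_square algebra_simps)
    also have "\<dots> \<le> (1 - norm z) * 2"
      using z by (intro mult_left_mono) auto
    finally have "1 - (norm z)\<^sup>2 \<le> (1 - norm z) * 2" .
    moreover have "1 * (norm (z - \<zeta>))\<^sup>2 \<le> 2 * pi * (norm (z - \<zeta>))\<^sup>2"
      using pi_gt3 by (intro mult_right_mono) auto
    ultimately have "(1 - (norm z)\<^sup>2) / (2 * pi * (norm (z - \<zeta>))\<^sup>2) \<le> (1 - norm z) * 2 / (1 * (norm (z - \<zeta>))\<^sup>2)"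
      using z d by (intro frac_le) auto
    then show ?thesis
      using 2 by (simp add: disc_kernel_def norm_minus_commute mult.commute ennreal_leI)
  qed (simp add: disc_kernel_def)
qed

text \<open>The same argument as for the upper bound, with \<open>ln x \<le> x - 1\<close> applied to \<open>d\<^sup>2 / a\<^sup>2\<close>.\<close>

lemma disc_kernel_ge:
  assumes z: "norm z < 1" and "norm \<zeta> \<le> 1"
  shows "ennreal ((1 - norm z) / (2 * pi * (norm (1 - z * cnj \<zeta>))\<^sup>2)) \<le> disc_kernel z \<zeta>"
proof -
  define a where "a = norm (1 - z * cnj \<zeta>)"
  define d where "d = norm (z - \<zeta>)"
  have a: "0 < a" unfolding a_def using assms by (intro one_minus_mult_cnj_nonzero) auto
  have ad: "a\<^sup>2 - d\<^sup>2 = (1 - (norm z)\<^sup>2) * (1 - (norm \<zeta>)\<^sup>2)"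
    using norm_one_minus_mult_cnj_sq[of z \<zeta>] by (simp add: a_def d_def)
  have z2: "1 - norm z \<le> 1 - (norm z)\<^sup>2"
    using z by (simp add: power2_eq_square mult_left_le)
  consider "norm \<zeta> < 1" "z \<noteq> \<zeta>" | "norm \<zeta> = 1" | "z = \<zeta>" using assms by linarith
  then show ?thesis
  proof cases
    case 1
    have d: "0 < d" using 1 by (simp add: d_def)
    have "(1 - norm z) * (1 - norm \<zeta>) \<le> (1 - (norm z)\<^sup>2) * (1 - (norm \<zeta>)\<^sup>2)"
      using z 1 z2 by (intro mult_mono) (auto simp: power2_eq_square mult_left_le mult_le_one)
    then have "(1 - norm z) * (1 - norm \<zeta>) / a\<^sup>2 \<le> (a\<^sup>2 - d\<^sup>2) / a\<^sup>2"
      using ad by (intro divide_right_mono) auto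
    also have "\<dots> = 1 - (d / a)\<^sup>2"
      using a by (simp add: power_divide diff_divide_distrib)
    also have "\<dots> \<le> - ln ((d / a)\<^sup>2)"
      using ln_le_minus_one[of "(d / a)\<^sup>2"] a d by simp
    also have "\<dots> = 2 * ln (a / d)"
      using a d by (simp add: ln_realpow ln_div)
    finally have "(1 - norm z) * (1 - norm \<zeta>) / a\<^sup>2 \<le> 2 * ln (a / d)" .
    then have "(1 - norm z) / (2 * a\<^sup>2) \<le> ln (a / d) / (1 - norm \<zeta>)"
      using 1 a by (simp add: field_simps)
    moreover have "(1 - norm z) / (2 * pi * a\<^sup>2) \<le> (1 - norm z) / (2 * a\<^sup>2)"
      using z a pi_gt3 by (intro divide_left_mono) auto
    ultimately show ?thesis
      unfolding disc_kernel_interior[OF z 1] a_def[symmetric] d_def[symmetric] by (intro ennreal_leI) auto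
  next
    case 2
    then have "a = d"
      using ad a d_def by (simp add: power2_eq_iff_nonneg)
    moreover have "(1 - norm z) / (2 * pi * a\<^sup>2) \<le> (1 - (norm z)\<^sup>2) / (2 * pi * a\<^sup>2)"
      using z2 by (intro divide_right_mono) auto
    ultimately show ?thesis
      using 2 by (simp add: disc_kernel_def norm_minus_commute a_def[symmetric] d_def ennreal_leI)
  qed (use z in \<open>simp add: disc_kernel_diagonal\<close>)
qed

text \<open>Close to \<open>z\<close> the weight \<open>1 - |\<zeta>|\<close> is comparable to \<open>1 - |z|\<close>, and the logarithmic singularity is
dominated by an arbitrarily small negative power of the distance.\<close>

lemma disc_kernel_near_le:
  assumes z: "norm z < 1" and ne: "z \<noteq> \<zeta>" and near: "norm (z - \<zeta>) \<le> (1 - norm z) / 2" and a: "0 < a"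
  shows "disc_kernel z \<zeta> \<le> ennreal (2 / (a * (1 - norm z)) * (3 * (1 - norm z) / norm (z - \<zeta>)) powr a)"
proof -
  have d: "0 < norm (z - \<zeta>)" using ne by simp
  have "norm \<zeta> \<le> norm z + norm (z - \<zeta>)"
    by (metis norm_minus_commute norm_triangle_sub)
  then have height: "(1 - norm z) / 2 \<le> 1 - norm \<zeta>"
    using near by simp
  then have \<zeta>: "norm \<zeta> < 1" using z by simp
  have b: "0 < norm (1 - z * cnj \<zeta>)"
    using z \<zeta> by (intro one_minus_mult_cnj_nonzero) auto
  have "1 - z * cnj \<zeta> = of_real (1 - (norm z)\<^sup>2) + z * cnj (z - \<zeta>)"
    by (simp add: algebra_simps complex_norm_square del: of_real_power)
  then have "norm (1 - z * cnj \<zeta>) \<le> norm (of_real (1 - (norm z)\<^sup>2) :: complex) + norm (z * cnj (z - \<zeta>))"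
    by (metis norm_triangle_ineq)
  also have "\<dots> \<le> (1 - norm z) * (1 + norm z) + 1 * norm (z - \<zeta>)"
    unfolding norm_of_real norm_mult complex_mod_cnj using z
    by (intro add_mono mult_right_mono) (auto simp: power2_eq_square algebra_simps mult_le_one abs_if  mult_left_le)
  also have "\<dots> \<le> (1 - norm z) * 2 + 1 * norm (z - \<zeta>)"
    using z by (intro add_mono mult_left_mono) auto
  finally have "norm (1 - z * cnj \<zeta>) \<le> 3 * (1 - norm z)" using near z by simp
  then have "ln (norm (1 - z * cnj \<zeta>) / norm (z - \<zeta>)) \<le> ln (3 * (1 - norm z) / norm (z - \<zeta>))"
    using z b d by (intro ln_mono divide_right_mono) auto
  also have "\<dots> \<le> (3 * (1 - norm z) / norm (z - \<zeta>)) powr a / a"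
    using d z a near by (intro ln_powr_bound) (auto simp: field_simps)
  finally have "ln (norm (1 - z * cnj \<zeta>) / norm (z - \<zeta>)) / (1 - norm \<zeta>)
      \<le> ((3 * (1 - norm z) / norm (z - \<zeta>)) powr a / a) / ((1 - norm z) / 2)"
    using z height a by (intro frac_le) auto
  also have "\<dots> = 2 / (a * (1 - norm z)) * (3 * (1 - norm z) / norm (z - \<zeta>)) powr a"
    by (simp add: field_simps)
  finally show ?thesis
    unfolding disc_kernel_interior[OF z \<zeta> ne] by (rule ennreal_leI)
qed

lemma borel_measurable_cnj [measurable]: "cnj \<in> borel_measurable borel"
  by (intro borel_measurable_continuous_onI continuous_intros)

lemma borel_measurable_cis [measurable]: "cis \<in> borel_measurable borel"
  by (intro borel_measurable_continuous_onI continuous_intros)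

lemma borel_measurable_disc_kernel [measurable (raw)]:
  assumes [measurable]: "f \<in> borel_measurable M" "g \<in> borel_measurable M"
  shows "(\<lambda>x. disc_kernel (f x) (g x)) \<in> borel_measurable M"
  unfolding disc_kernel_def elog_def by measurable

lemma borel_measurable_Arg [measurable]: "Arg \<in> borel_measurable borel"
proof -
  have [measurable]: "(\<real>\<^sub>\<le>\<^sub>0 :: complex set) \<in> sets borel"
    by (intro borel_closed closed_nonpos_Reals_complex)
  have [measurable]: "(\<lambda>z. indicator (- \<real>\<^sub>\<le>\<^sub>0) z *\<^sub>R Arg z) \<in> borel_measurable borel"
    by (intro borel_measurable_continuous_on_indicator continuous_on_Arg) auto
  have "(\<lambda>z. indicator (- \<real>\<^sub>\<le>\<^sub>0) z *\<^sub>R Arg z + (if z \<in> \<real>\<^sub>\<le>\<^sub>0 then if z = 0 then 0 else pi else 0)) \<in> borel_measurable borel"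
    by measurable
  moreover have "Arg z = indicator (- \<real>\<^sub>\<le>\<^sub>0) z *\<^sub>R Arg z + (if z \<in> \<real>\<^sub>\<le>\<^sub>0 then if z = 0 then 0 else pi else 0)" for z
  proof (cases "z \<in> \<real>\<^sub>\<le>\<^sub>0 \<and> z \<noteq> 0")
    case True
    then have "Re z < 0 \<and> Im z = 0"
      by (metis complex_eq_iff complex_nonpos_Reals_iff less_eq_real_def zero_complex.simps)
    then show ?thesis using True by (simp add: Arg_eq_pi)
  qed (auto simp: Arg_zero)
  ultimately show ?thesis by (simp cong: measurable_cong)
qed

section \<open>Angles and distances\<close>

text \<open>Jordan's inequality: the concave function sin lies above its chord on \<open>[0, \<pi>/2]\<close>.\<close>

lemma two_mult_le_pi_mult_sin:
  assumes "0 \<le> x" "x \<le> pi / 2"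
  shows "2 * x \<le> pi * sin x"
proof -
  have "concave_on {0..pi / 2} sin"
  proof (rule f''_le0_imp_concave)
    show "(sin has_real_derivative cos y) (at y)" for y by (rule DERIV_sin)
    show "(cos has_real_derivative - sin y) (at y)" for y by (rule DERIV_cos)
    show "- sin y \<le> 0" if "y \<in> {0..pi / 2}" for y
      using that by (auto intro!: sin_ge_zero)
  qed auto
  from concave_onD_Icc'[OF this, of x] assms show ?thesis
    by (simp add: field_simps)
qed

lemma norm_cis_minus_one: "norm (cis x - 1) = 2 * \<bar>sin (x / 2)\<bar>"
proof (rule power2_eq_imp_eq)
  have "(norm (cis x - 1))\<^sup>2 = 2 - 2 * cos x"
    using sin_cos_squared_add[of x]
    by (simp only: cmod_power2) (simp add: power2_eq_square algebra_simps)
  also have "\<dots> = 2 - 2 * cos (2 * (x / 2))" by simp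
  also have "\<dots> = (2 * \<bar>sin (x / 2)\<bar>)\<^sup>2"
    by (simp only: cos_double_sin) (simp add: power_mult_distrib)
  finally show "(norm (cis x - 1))\<^sup>2 = (2 * \<bar>sin (x / 2)\<bar>)\<^sup>2" .
qed auto

lemma norm_cis_minus_one_le: "norm (cis x - 1) \<le> \<bar>x\<bar>"
  using abs_sin_x_le_abs_x[of "x / 2"] by (simp add: norm_cis_minus_one)

lemma abs_le_norm_cis_minus_one:
  assumes "\<bar>x\<bar> \<le> pi"
  shows "\<bar>x\<bar> \<le> pi / 2 * norm (cis x - 1)"
proof -
  have "\<bar>x\<bar> \<le> pi * \<bar>sin (x / 2)\<bar>"
  proof -
    have "\<bar>x\<bar> = 2 * \<bar>x / 2\<bar>" by simp
    also have "\<dots> \<le> pi * sin \<bar>x / 2\<bar>"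
      using assms by (intro two_mult_le_pi_mult_sin) auto
    also have "\<dots> \<le> pi * \<bar>sin (x / 2)\<bar>"
      by (intro mult_left_mono) (auto simp: abs_if)
    finally show ?thesis .
  qed
  then show ?thesis by (simp add: norm_cis_minus_one)
qed

lemma norm_normalize_diff_le:
  fixes z w :: "'a::real_normed_vector"
  assumes "z \<noteq> 0"
  shows "norm (sgn z - sgn w) \<le> 2 * norm (z - w) / norm z"
proof -
  have "norm z *\<^sub>R (sgn z - sgn w) = (z - w) + (norm w - norm z) *\<^sub>R sgn w"
    by (cases "w = 0") (auto simp: sgn_div_norm algebra_simps assms)
  then have "norm z * norm (sgn z - sgn w) \<le> norm (z - w) + \<bar>norm w - norm z\<bar> * norm (sgn w)"
    by (metis abs_norm_cancel norm_scaleR norm_triangle_ineq)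
  also have "\<dots> \<le> norm (z - w) + norm (z - w) * 1"
    by (intro add_mono mult_mono) (auto simp: norm_sgn norm_minus_commute norm_triangle_ineq3)
  finally show ?thesis using assms by (simp add: field_simps)
qed

lemma ex_int_shift_abs_le_pi: "\<exists>k::int. \<bar>x + 2 * pi * of_int k\<bar> \<le> pi"
proof
  define k where "k = - round (x / (2 * pi))"
  have "\<bar>x / (2 * pi) + of_int k\<bar> \<le> 1 / 2"
    using of_int_round_abs_le[of "x / (2 * pi)"] by (simp add: k_def abs_minus_commute)
  then have "\<bar>x / (2 * pi) + of_int k\<bar> * (2 * pi) \<le> 1 / 2 * (2 * pi)"
    by (intro mult_right_mono) auto
  also have "\<bar>x / (2 * pi) + of_int k\<bar> * (2 * pi) = \<bar>(x / (2 * pi) + of_int k) * (2 * pi)\<bar>"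
    by (simp add: abs_mult)
  also have "(x / (2 * pi) + of_int k) * (2 * pi) = x + 2 * pi * of_int k"
    by (simp add: field_simps)
  finally show "\<bar>x + 2 * pi * of_int k\<bar> \<le> pi" by simp
qed

lemma cis_shift: "cis (x + 2 * pi * of_int k) = cis x"
  by (simp add: cis_multiple_2pi flip: cis_mult)

text \<open>A point at a small distance from \<open>r e\<^sup>i\<^sup>\<phi>\<close> has an argument close to \<open>\<phi>\<close>: projecting radially to the unit
circle costs the factor \<open>2 / r\<close>, and passing from the chord to the arc costs \<open>\<pi> / 2\<close>.\<close>

lemma angle_le_norm_diff:
  assumes r: "1 / 2 \<le> r" and \<zeta>: "\<zeta> \<noteq> 0"
    and k: "\<bar>Arg \<zeta> - \<phi> + 2 * pi * of_int k\<bar> \<le> pi"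
  shows "\<bar>Arg \<zeta> - \<phi> + 2 * pi * of_int k\<bar> \<le> 2 * pi * norm (of_real r * cis \<phi> - \<zeta>)"
proof -
  define z where "z = of_real r * cis \<phi>"
  have z: "norm z = r" "z \<noteq> 0" "sgn z = cis \<phi>"
    using r by (auto simp: z_def norm_mult sgn_mult sgn_of_real)
  have "norm (sgn z - sgn \<zeta>) = norm (cis \<phi>) * norm (cis (Arg \<zeta> - \<phi> + 2 * pi * of_int k) - 1)"
    unfolding cis_shift norm_mult[symmetric]
    using \<zeta> by (simp add: right_diff_distrib cis_mult z cis_Arg norm_minus_commute)
  moreover have "2 / pi * \<bar>Arg \<zeta> - \<phi> + 2 * pi * of_int k\<bar>
      \<le> norm (cis (Arg \<zeta> - \<phi> + 2 * pi * of_int k) - 1)"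
    using abs_le_norm_cis_minus_one[OF k] by (simp add: field_simps)
  ultimately have "2 / pi * \<bar>Arg \<zeta> - \<phi> + 2 * pi * of_int k\<bar> \<le> 2 * norm (z - \<zeta>) / r"
    using norm_normalize_diff_le[of z \<zeta>] z by simp
  also have "\<dots> \<le> 2 * norm (z - \<zeta>) / (1 / 2)"
    using r by (intro divide_left_mono) auto
  finally show ?thesis by (simp add: z_def field_simps)
qed

section \<open>Carleson boxes\<close>

lemma carleson_box_subset_cball: "carleson_box \<phi> \<delta> \<subseteq> cball 0 1"
  by (auto simp: carleson_box_def)

lemma carleson_boxI:
  assumes "1 - \<delta> \<le> norm \<zeta>" "norm \<zeta> \<le> 1" "\<bar>Arg \<zeta> - \<phi> + 2 * pi * of_int k\<bar> \<le> pi * \<delta>"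
  shows "\<zeta> \<in> carleson_box \<phi> \<delta>"
  using assms unfolding carleson_box_def by auto

lemma carleson_boxE:
  assumes "\<zeta> \<in> carleson_box \<phi> \<delta>"
  obtains k :: int where "1 - \<delta> \<le> norm \<zeta>" "norm \<zeta> \<le> 1" "\<bar>Arg \<zeta> - \<phi> + 2 * pi * of_int k\<bar> \<le> pi * \<delta>"
  using assms unfolding carleson_box_def by auto

lemma carleson_box_eq_cball:
  assumes "1 \<le> \<delta>"
  shows "carleson_box \<phi> \<delta> = cball 0 1"
proof -
  have "\<exists>k::int. \<bar>Arg \<zeta> - \<phi> + 2 * pi * of_int k\<bar> \<le> pi * \<delta>" for \<zeta>
  proof -
    obtain k :: int where "\<bar>Arg \<zeta> - \<phi> + 2 * pi * of_int k\<bar> \<le> pi"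
      using ex_int_shift_abs_le_pi by blast
    also have "pi \<le> pi * \<delta>" using assms by simp
    finally show ?thesis by blast
  qed
  moreover have "1 - \<delta> \<le> norm \<zeta>" for \<zeta> :: complex
    using assms norm_ge_zero[of \<zeta>] by linarith
  ultimately show ?thesis
    by (auto simp: carleson_box_def)
qed

lemma pred_carleson_box [measurable (raw)]:
  assumes [measurable]: "f \<in> borel_measurable M" "g \<in> borel_measurable M"
  shows "Measurable.pred M (\<lambda>x. g x \<in> carleson_box (f x) \<delta>)"
  unfolding carleson_box_def by (simp add: mem_cball_0)

lemma borel_carleson_box [measurable, simp]: "carleson_box \<phi> \<delta> \<in> sets borel"
  using pred_carleson_box[of "\<lambda>_. \<phi>" borel "\<lambda>x. x" \<delta>]
  by (simp add: pred_def)

text \<open>Boxes behave like balls of a metric in the angular variable; this rule and the next are its two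
triangle inequalities.\<close>

lemma carleson_box_trans:
  assumes "\<zeta> \<in> carleson_box \<phi> s" "\<xi> \<in> carleson_box (Arg \<zeta>) t" "0 \<le> s"
  shows "\<xi> \<in> carleson_box \<phi> (s + t)"
proof -
  obtain k l :: int where kl: "\<bar>Arg \<zeta> - \<phi> + 2 * pi * of_int k\<bar> \<le> pi * s"
      "\<bar>Arg \<xi> - Arg \<zeta> + 2 * pi * of_int l\<bar> \<le> pi * t"
    using assms by (auto simp: carleson_box_def)
  have "Arg \<xi> - \<phi> + 2 * pi * of_int (k + l)
      = (Arg \<zeta> - \<phi> + 2 * pi * of_int k) + (Arg \<xi> - Arg \<zeta> + 2 * pi * of_int l)"
    by (simp add: algebra_simps)
  then have "\<bar>Arg \<xi> - \<phi> + 2 * pi * of_int (k + l)\<bar> \<le> pi * (s + t)"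
    using kl unfolding distrib_left by linarith
  moreover have "1 - (s + t) \<le> norm \<xi>" "norm \<xi> \<le> 1"
    using assms by (auto simp: carleson_box_def)
  ultimately show ?thesis by (intro carleson_boxI)
qed

lemma carleson_box_recentre:
  assumes "\<zeta> \<in> carleson_box \<phi> s" "\<xi> \<in> carleson_box \<phi> t" "0 \<le> s"
  shows "\<xi> \<in> carleson_box (Arg \<zeta>) (s + t)"
proof -
  obtain k l :: int where kl: "\<bar>Arg \<zeta> - \<phi> + 2 * pi * of_int k\<bar> \<le> pi * s"
      "\<bar>Arg \<xi> - \<phi> + 2 * pi * of_int l\<bar> \<le> pi * t"
    using assms by (auto simp: carleson_box_def)
  have "Arg \<xi> - Arg \<zeta> + 2 * pi * of_int (l - k)
      = (Arg \<xi> - \<phi> + 2 * pi * of_int l) - (Arg \<zeta> - \<phi> + 2 * pi * of_int k)"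
    by (simp add: algebra_simps)
  then have "\<bar>Arg \<xi> - Arg \<zeta> + 2 * pi * of_int (l - k)\<bar> \<le> pi * (s + t)"
    using kl unfolding distrib_left by linarith
  moreover have "1 - (s + t) \<le> norm \<xi>" "norm \<xi> \<le> 1"
    using assms by (auto simp: carleson_box_def)
  ultimately show ?thesis by (intro carleson_boxI)
qed

lemma carleson_box_mono:
  assumes "s \<le> t"
  shows "carleson_box \<phi> s \<subseteq> carleson_box \<phi> t"
proof -
  have "pi * s \<le> pi * t" using assms by simp
  then show ?thesis using assms
    by (auto elim!: carleson_boxE intro!: carleson_boxI intro: order.trans)
qed

lemma norm_circle_point: "\<delta> \<le> 1 \<Longrightarrow> norm (of_real (1 - \<delta>) * cis \<phi> :: complex) = 1 - \<delta>"
  by (simp only: norm_mult norm_of_real norm_cis) simp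

text \<open>Euclidean discs around \<open>(1 - \<delta>) e\<^sup>i\<^sup>\<phi>\<close> of radius at least \<open>\<delta> / 2\<close> are contained in boxes of comparable
size. This is how every estimate in terms of \<open>|z - \<zeta>|\<close> becomes one in terms of boxes.\<close>

lemma near_imp_carleson_box:
  assumes "0 < \<delta>" "\<delta> \<le> 1 / 2" "norm \<zeta> \<le> 1" "\<delta> \<le> 2 * t"
    and near: "norm (of_real (1 - \<delta>) * cis \<phi> - \<zeta>) \<le> t"
  shows "\<zeta> \<in> carleson_box \<phi> (4 * t)"
proof (cases "\<zeta> = 0")
  case True
  then have "1 - \<delta> \<le> t" using near assms norm_circle_point[of \<delta> \<phi>] by simp
  then have "1 \<le> 4 * t" using assms by simp
  then show ?thesis using assms by (simp add: carleson_box_eq_cball)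
next
  case False
  obtain k :: int where k: "\<bar>Arg \<zeta> - \<phi> + 2 * pi * of_int k\<bar> \<le> pi"
    using ex_int_shift_abs_le_pi by blast
  have "\<bar>Arg \<zeta> - \<phi> + 2 * pi * of_int k\<bar> \<le> 2 * pi * norm (of_real (1 - \<delta>) * cis \<phi> - \<zeta>)"
    using assms False k by (intro angle_le_norm_diff) auto
  also have "\<dots> \<le> 2 * pi * (2 * t)"
    using near assms by (intro mult_left_mono) auto
  finally have "\<bar>Arg \<zeta> - \<phi> + 2 * pi * of_int k\<bar> \<le> pi * (4 * t)" by simp
  moreover have "norm (of_real (1 - \<delta>) * cis \<phi> :: complex) = 1 - \<delta>"
    using assms by (intro norm_circle_point) simp
  then have "1 - \<delta> \<le> norm \<zeta> + t"
    using near norm_triangle_sub[of "of_real (1 - \<delta>) * cis \<phi>" \<zeta>] by simp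
  ultimately show ?thesis
    using assms unfolding carleson_box_def by auto
qed

lemma norm_one_minus_mult_cnj_le:
  assumes "0 < \<delta>" "\<delta> < 1" "\<zeta> \<in> carleson_box \<phi> \<delta>"
  shows "norm (1 - of_real (1 - \<delta>) * cis \<phi> * cnj \<zeta>) \<le> 6 * \<delta>"
proof -
  obtain k :: int where k: "\<bar>Arg \<zeta> - \<phi> + 2 * pi * of_int k\<bar> \<le> pi * \<delta>"
    and \<zeta>: "1 - \<delta> \<le> norm \<zeta>" "norm \<zeta> \<le> 1"
    using assms by (auto simp: carleson_box_def)
  define x where "x = - (Arg \<zeta> - \<phi> + 2 * pi * of_int k)"
  define r where "r = (1 - \<delta>) * norm \<zeta>"
  have r: "0 \<le> r" "r \<le> 1" "(1 - \<delta>) * (1 - \<delta>) \<le> r"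
    using assms \<zeta> by (auto simp: r_def mult_le_one intro!: mult_left_mono)
  have "cnj \<zeta> = of_real (norm \<zeta>) * cis (- Arg \<zeta>)"
    using rcis_cmod_Arg[of \<zeta>] by (metis cis_cnj complex_cnj_complex_of_real complex_cnj_mult rcis_def)
  moreover have "cis \<phi> * cis (- Arg \<zeta>) = cis x"
    using cis_shift[of "\<phi> - Arg \<zeta>" "-k"] by (simp add: x_def cis_mult algebra_simps)
  ultimately have "of_real (1 - \<delta>) * cis \<phi> * cnj \<zeta> = of_real r * cis x"
    by (simp add: r_def mult_ac)
  then have "1 - of_real (1 - \<delta>) * cis \<phi> * cnj \<zeta> = of_real (1 - r) - of_real r * (cis x - 1)"
    by (simp add: algebra_simps)
  then have "norm (1 - of_real (1 - \<delta>) * cis \<phi> * cnj \<zeta>) \<le> norm (of_real (1 - r) :: complex) + norm (of_real r * (cis x - 1))"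
    by (metis norm_triangle_ineq4)
  also have "\<dots> = (1 - r) + r * norm (cis x - 1)"
    unfolding norm_mult norm_of_real using r by simp
  also have "\<dots> \<le> (1 - r) + 1 * (4 * \<delta>)"
  proof (intro add_left_mono mult_mono r)
    have "norm (cis x - 1) \<le> \<bar>x\<bar>" by (rule norm_cis_minus_one_le)
    also have "\<dots> \<le> pi * \<delta>" using k by (simp add: x_def)
    also have "\<dots> \<le> 4 * \<delta>" using pi_less_4 assms by (intro mult_right_mono) auto
    finally show "norm (cis x - 1) \<le> 4 * \<delta>" .
  qed auto
  also have "\<dots> \<le> 6 * \<delta>"
  proof -
    have "1 - 2 * \<delta> \<le> (1 - \<delta>) * (1 - \<delta>)" by (simp add: algebra_simps)
    then show ?thesis using r by simp
  qed
  finally show ?thesis .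
qed

section \<open>Potentials and boxes at a single point\<close>

definition disc_potential :: "complex measure \<Rightarrow> complex \<Rightarrow> ennreal" where
  "disc_potential \<Lambda> z = (\<integral>\<^sup>+\<zeta>. disc_kernel z \<zeta> \<partial>\<Lambda>)"

lemma borel_measurable_disc_potential [measurable (raw)]:
  assumes "finite_measure \<Lambda>" and [measurable_cong]: "sets \<Lambda> = sets borel"
    and [measurable]: "f \<in> borel_measurable M"
  shows "(\<lambda>x. disc_potential \<Lambda> (f x)) \<in> borel_measurable M"
proof -
  interpret finite_measure \<Lambda> by fact
  show ?thesis unfolding disc_potential_def by measurable
qed

lemma borel_measurable_emeasure_carleson_box:
  assumes "finite_measure \<Lambda>" and [measurable_cong]: "sets \<Lambda> = sets borel"
    and [measurable]: "f \<in> borel_measurable M"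
  shows "(\<lambda>x. emeasure \<Lambda> (carleson_box (f x) s)) \<in> borel_measurable M"
proof -
  interpret finite_measure \<Lambda> by fact
  have "(\<lambda>x. \<integral>\<^sup>+\<zeta>. indicator (carleson_box (f x) s) \<zeta> \<partial>\<Lambda>) \<in> borel_measurable M"
    by measurable
  then show ?thesis by (simp add: assms)
qed

text \<open>On the box the kernel is at least \<open>\<delta> / (2 \<pi> (6 \<delta>)\<^sup>2) = 1 / (72 \<pi> \<delta>)\<close>.\<close>

lemma emeasure_carleson_box_le_potential:
  assumes [measurable_cong]: "sets \<Lambda> = sets borel" and \<delta>: "0 < \<delta>" "\<delta> < 1"
  shows "emeasure \<Lambda> (carleson_box \<phi> \<delta>) \<le> ennreal (72 * pi * \<delta>) * disc_potential \<Lambda> (of_real (1 - \<delta>) * cis \<phi>)"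
proof -
  define z where "z = of_real (1 - \<delta>) * cis \<phi>"
  have z: "norm z = 1 - \<delta>" using \<delta> unfolding z_def by (intro norm_circle_point) simp
  have "ennreal (1 / (72 * pi * \<delta>)) * indicator (carleson_box \<phi> \<delta>) \<zeta> \<le> disc_kernel z \<zeta>" for \<zeta>
  proof (cases "\<zeta> \<in> carleson_box \<phi> \<delta>")
    case True
    then have \<zeta>: "norm \<zeta> \<le> 1" by (auto simp: carleson_box_def)
    have "0 < norm (1 - z * cnj \<zeta>)" using z \<delta> \<zeta> by (intro one_minus_mult_cnj_nonzero) auto
    moreover have "(norm (1 - z * cnj \<zeta>))\<^sup>2 \<le> (6 * \<delta>)\<^sup>2"
      unfolding z_def using True \<delta> by (intro power_mono norm_one_minus_mult_cnj_le) auto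
    ultimately have "\<delta> / (2 * pi * (6 * \<delta>)\<^sup>2) \<le> \<delta> / (2 * pi * (norm (1 - z * cnj \<zeta>))\<^sup>2)"
      using \<delta> by (intro divide_left_mono) auto
    moreover have "\<delta> / (2 * pi * (6 * \<delta>)\<^sup>2) = 1 / (72 * pi * \<delta>)"
      using \<delta> by (simp add: power2_eq_square)
    ultimately have "ennreal (1 / (72 * pi * \<delta>)) \<le> ennreal ((1 - norm z) / (2 * pi * (norm (1 - z * cnj \<zeta>))\<^sup>2))"
      using z by (intro ennreal_leI) simp
    also have "\<dots> \<le> disc_kernel z \<zeta>" using z \<delta> \<zeta> by (intro disc_kernel_ge) auto
    finally show ?thesis using True by simp
  qed simp
  then have "(\<integral>\<^sup>+\<zeta>. ennreal (1 / (72 * pi * \<delta>)) * indicator (carleson_box \<phi> \<delta>) \<zeta> \<partial>\<Lambda>) \<le> disc_potential \<Lambda> z"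
    unfolding disc_potential_def by (intro nn_integral_mono)
  then have "ennreal (1 / (72 * pi * \<delta>)) * emeasure \<Lambda> (carleson_box \<phi> \<delta>) \<le> disc_potential \<Lambda> z"
    by (simp add: nn_integral_cmult_indicator assms)
  then have "ennreal (72 * pi * \<delta>) * (ennreal (1 / (72 * pi * \<delta>)) * emeasure \<Lambda> (carleson_box \<phi> \<delta>)) \<le> ennreal (72 * pi * \<delta>) * disc_potential \<Lambda> z"
    by (rule mult_left_mono) simp
  moreover have "ennreal (72 * pi * \<delta>) * ennreal (1 / (72 * pi * \<delta>)) = 1"
    using \<delta> by (simp flip: ennreal_mult)
  ultimately show ?thesis by (simp add: z_def flip: mult.assoc)
qed

text \<open>Dyadic shells: if \<open>\<zeta>\<close> lies between the distances \<open>d = 2\<^sup>k \<delta> / 2\<close> and \<open>2 d\<close> from \<open>z\<close>, then the kernel is at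
most \<open>2 \<delta> / d\<^sup>2\<close>, which is the coefficient of the term with index \<open>k + 1\<close>, and \<open>\<zeta>\<close> lies in the box of that
term. Boxes of size at least 1 are the whole closed disc, so the sum over all \<open>k\<close> needs no cut-off.\<close>

lemma disc_kernel_far_le:
  assumes \<delta>: "0 < \<delta>" "\<delta> \<le> 1 / 2" and z: "z = of_real (1 - \<delta>) * cis \<phi>"
    and far: "\<delta> / 2 < norm (z - \<zeta>)"
  shows "disc_kernel z \<zeta> \<le> (\<Sum>k. ennreal (32 / \<delta> * (1 / 4) ^ k) * indicator (carleson_box \<phi> (2 ^ Suc k * \<delta>)) \<zeta>)"
proof (cases "norm \<zeta> \<le> 1")
  case True
  have nz: "norm z = 1 - \<delta>" using \<delta> unfolding z by (intro norm_circle_point) simp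
  define P where "P k \<longleftrightarrow> norm (z - \<zeta>) \<le> 2 ^ k * \<delta> / 2" for k :: nat
  \<comment> \<open>\<open>k\<close> will be the last index at which the disc of radius \<open>2\<^sup>k \<delta> / 2\<close> around \<open>z\<close> still misses \<open>\<zeta>\<close>.\<close>
  obtain n :: nat where "2 * norm (z - \<zeta>) / \<delta> < 2 ^ n"
    using real_arch_pow[of 2] by auto
  then have "P n" using \<delta> by (simp add: P_def field_simps)
  moreover have "\<not> P 0" using far by (simp add: P_def)
  ultimately obtain k where k: "\<not> P k" "P (Suc k)"
    using ex_least_nat_less[of P n] by blast
  define d where "d = 2 ^ k * \<delta> / 2"
  have d: "0 < d" "d < norm (z - \<zeta>)" "norm (z - \<zeta>) \<le> 2 * d"
    using k \<delta> by (auto simp: P_def d_def)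
  have "\<zeta> \<in> carleson_box \<phi> (4 * (2 * d))"
  proof (rule near_imp_carleson_box[OF \<delta> True])
    have "1 * \<delta> \<le> 2 ^ k * \<delta>" using \<delta> by (intro mult_right_mono) auto
    then show "\<delta> \<le> 2 * (2 * d)" using \<delta> unfolding d_def by linarith
  qed (use d z in auto)
  also have "4 * (2 * d) = 2 ^ Suc (Suc k) * \<delta>" by (simp add: d_def)
  finally have box: "\<zeta> \<in> carleson_box \<phi> (2 ^ Suc (Suc k) * \<delta>)" .
  have "disc_kernel z \<zeta> \<le> ennreal (2 * (1 - norm z) / (norm (z - \<zeta>))\<^sup>2)"
    using nz \<delta> d by (intro disc_kernel_le) auto
  also have "2 * (1 - norm z) / (norm (z - \<zeta>))\<^sup>2 \<le> 2 * \<delta> / d\<^sup>2"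
    using d \<delta> nz by (intro frac_le power_mono) auto
  also have "2 * \<delta> / d\<^sup>2 = 32 / \<delta> * (1 / 4) ^ Suc k"
    using \<delta> by (simp add: d_def power2_eq_square power_divide field_simps flip: power_mult_distrib)
  also have "ennreal (32 / \<delta> * (1 / 4) ^ Suc k)
      = (\<Sum>k\<in>{Suc k}. ennreal (32 / \<delta> * (1 / 4) ^ k) * indicator (carleson_box \<phi> (2 ^ Suc k * \<delta>)) \<zeta>)"
    using box by simp
  also have "\<dots> \<le> (\<Sum>k. ennreal (32 / \<delta> * (1 / 4) ^ k) * indicator (carleson_box \<phi> (2 ^ Suc k * \<delta>)) \<zeta>)"
    by (intro sum_le_suminf summableI) auto
  finally show ?thesis by (simp add: ennreal_leI)
qed (simp add: disc_kernel_def)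

section \<open>The far part of the potential\<close>

definition box_energy :: "real \<Rightarrow> complex measure \<Rightarrow> real \<Rightarrow> ennreal" where
  "box_energy p \<Lambda> s = (\<integral>\<^sup>+ \<phi>\<in>{0..2*pi}. ennreal_powr (emeasure \<Lambda> (carleson_box \<phi> s)) p \<partial>lborel)"

text \<open>The coefficients are split as \<open>4\<^sup>-\<^sup>k = 2\<^sup>-\<^sup>k \<cdot> 2\<^sup>-\<^sup>k\<close>: one factor serves as the weight in Jensen's inequality,
and the other compensates the growth \<open>2\<^sup>k\<^sup>\<gamma>\<close> of the energy of the boxes, which is possible because
\<open>\<gamma> \<le> 1\<close>.\<close>

lemma far_sum_energy:
  assumes fin: "finite_measure \<Lambda>" and sets: "sets \<Lambda> = sets borel"
    and p: "1 < p" and \<gamma>: "\<gamma> \<le> 1" and \<delta>: "0 < \<delta>" and M: "0 \<le> M"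
    and energy: "\<And>s. 0 < s \<Longrightarrow> box_energy p \<Lambda> s \<le> ennreal (M * s powr (\<gamma> * p))"
  shows "(\<integral>\<^sup>+ \<phi>\<in>{0..2*pi}. ennreal_powr
      (\<Sum>k. ennreal (32 / \<delta> * (1 / 4) ^ k) * emeasure \<Lambda> (carleson_box \<phi> (2 ^ Suc k * \<delta>))) p \<partial>lborel)
    \<le> ennreal (2 powr p * (32 / \<delta>) powr p * M * (2 * \<delta>) powr (\<gamma> * p))"
proof -
  note [measurable] = borel_measurable_emeasure_carleson_box[OF fin sets]
  define E where "E k \<phi> = emeasure \<Lambda> (carleson_box \<phi> (2 ^ Suc k * \<delta>))" for k \<phi>
  have [measurable]: "E k \<in> borel_measurable borel" for k
    unfolding E_def by measurable
  have weights: "(\<Sum>k. ennreal ((1 / 2) ^ k)) = ennreal 2"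
  proof (rule suminf_ennreal_eq)
    show "(\<lambda>k. (1 / 2 :: real) ^ k) sums 2" using geometric_sums[of "1 / 2 :: real"] by simp
  qed auto
  have Jensen: "ennreal_powr (\<Sum>k. ennreal (32 / \<delta> * (1 / 4) ^ k) * E k \<phi>) p
      \<le> ennreal (2 powr (p - 1)) * (\<Sum>k. ennreal ((1 / 2) ^ k) * ennreal_powr (ennreal (32 / \<delta> * (1 / 2) ^ k) * E k \<phi>) p)"
    for \<phi>
  proof -
    have "ennreal (32 / \<delta> * (1 / 4) ^ k) = ennreal ((1 / 2) ^ k) * ennreal (32 / \<delta> * (1 / 2) ^ k)" for k
      using \<delta> by (simp add: power_mult_distrib[symmetric] mult_ac flip: ennreal_mult)
    moreover have "ennreal_powr 2 (p - 1) = ennreal (2 powr (p - 1))"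
      using ennreal_powr_ennreal[of 2 "p - 1"] by simp
    ultimately show ?thesis
      using nn_integral_powr_Jensen[of "\<lambda>k. ennreal ((1 / 2) ^ k)" "count_space UNIV"
          "\<lambda>k. ennreal (32 / \<delta> * (1 / 2) ^ k) * E k \<phi>" p] p weights
      by (simp add: nn_integral_count_space_nat ennreal_powr_ennreal mult.assoc)
  qed
  have scale: "(\<integral>\<^sup>+ \<phi>\<in>{0..2*pi}. ennreal_powr (ennreal (32 / \<delta> * (1 / 2) ^ k) * E k \<phi>) p \<partial>lborel)
      \<le> ennreal ((32 / \<delta>) powr p * M * (2 * \<delta>) powr (\<gamma> * p))" for k
  proof -
    have "(\<integral>\<^sup>+ \<phi>\<in>{0..2*pi}. ennreal_powr (ennreal (32 / \<delta> * (1 / 2) ^ k) * E k \<phi>) p \<partial>lborel)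
        = ennreal ((32 / \<delta> * (1 / 2) ^ k) powr p) * box_energy p \<Lambda> (2 ^ Suc k * \<delta>)"
      unfolding box_energy_def E_def[symmetric] using p \<delta>
      by (subst nn_integral_cmult[symmetric]) (auto simp: ennreal_powr_mult ennreal_powr_ennreal mult.assoc)
    also have "\<dots> \<le> ennreal ((32 / \<delta> * (1 / 2) ^ k) powr p) * ennreal (M * (2 ^ Suc k * \<delta>) powr (\<gamma> * p))"
      using \<delta> by (intro mult_left_mono energy) auto
    also have "\<dots> = ennreal ((32 / \<delta> * (1 / 2) ^ k) powr p * (M * (2 ^ Suc k * \<delta>) powr (\<gamma> * p)))"
      using M by (simp add: ennreal_mult)
    also have "\<dots> \<le> ennreal ((32 / \<delta>) powr p * M * (2 * \<delta>) powr (\<gamma> * p))"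
    proof (rule ennreal_leI)
      have "(1 / 2 :: real) ^ k = 2 powr (- real k)" "(2 :: real) ^ k = 2 powr real k"
        by (simp_all add: powr_minus powr_realpow power_one_over inverse_eq_divide)
      then have "((1 / 2) ^ k) powr p * ((2::real) ^ k) powr (\<gamma> * p) = 2 powr (- real k * p + real k * (\<gamma> * p))"
        by (simp only: powr_powr powr_add)
      also have "- real k * p + real k * (\<gamma> * p) = real k * (\<gamma> - 1) * p"
        by (simp add: algebra_simps)
      also have "2 powr (real k * (\<gamma> - 1) * p) \<le> 2 powr (0 :: real)"
        using p \<gamma> by (intro powr_mono mult_nonpos_nonneg mult_nonneg_nonpos) auto
      finally have *: "((1 / 2) ^ k) powr p * ((2::real) ^ k) powr (\<gamma> * p) \<le> 1" by simp
      have "(32 / \<delta> * (1 / 2) ^ k) powr p * (M * (2 ^ Suc k * \<delta>) powr (\<gamma> * p))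
        = ((32 / \<delta>) powr p * M * (2 * \<delta>) powr (\<gamma> * p)) * (((1 / 2) ^ k) powr p * (2 ^ k) powr (\<gamma> * p))"
      proof -
        have "(32 / \<delta> * (1 / 2) ^ k) powr p = (32 / \<delta>) powr p * ((1 / 2) ^ k) powr p"
          by (rule powr_mult)
        moreover have "2 ^ Suc k * \<delta> = (2 * \<delta>) * 2 ^ k" by simp
        then have "(2 ^ Suc k * \<delta>) powr (\<gamma> * p) = (2 * \<delta>) powr (\<gamma> * p) * (2 ^ k) powr (\<gamma> * p)"
          using \<delta> by (simp only: powr_mult)
        ultimately show ?thesis by (simp only: mult_ac)
      qed
      also have "\<dots> \<le> ((32 / \<delta>) powr p * M * (2 * \<delta>) powr (\<gamma> * p)) * 1"
        using * M by (intro mult_left_mono) auto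
      finally show "(32 / \<delta> * (1 / 2) ^ k) powr p * (M * (2 ^ Suc k * \<delta>) powr (\<gamma> * p))
        \<le> (32 / \<delta>) powr p * M * (2 * \<delta>) powr (\<gamma> * p)" by simp
    qed
    finally show ?thesis .
  qed
  have "(\<integral>\<^sup>+ \<phi>\<in>{0..2*pi}. ennreal_powr (\<Sum>k. ennreal (32 / \<delta> * (1 / 4) ^ k) * E k \<phi>) p \<partial>lborel)
      \<le> (\<integral>\<^sup>+ \<phi>. ennreal (2 powr (p - 1)) * (\<Sum>k. ennreal ((1 / 2) ^ k) *
          (ennreal_powr (ennreal (32 / \<delta> * (1 / 2) ^ k) * E k \<phi>) p * indicator {0..2*pi} \<phi>)) \<partial>lborel)"
  proof (intro nn_integral_mono)
    fix \<phi>
    show "ennreal_powr (\<Sum>k. ennreal (32 / \<delta> * (1 / 4) ^ k) * E k \<phi>) p * indicator {0..2*pi} \<phi>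
      \<le> ennreal (2 powr (p - 1)) * (\<Sum>k. ennreal ((1 / 2) ^ k) *
          (ennreal_powr (ennreal (32 / \<delta> * (1 / 2) ^ k) * E k \<phi>) p * indicator {0..2*pi} \<phi>))"
      using Jensen[of \<phi>] by (auto simp: indicator_def)
  qed
  also have "\<dots> = ennreal (2 powr (p - 1)) * (\<Sum>k. ennreal ((1 / 2) ^ k) *
      (\<integral>\<^sup>+ \<phi>\<in>{0..2*pi}. ennreal_powr (ennreal (32 / \<delta> * (1 / 2) ^ k) * E k \<phi>) p \<partial>lborel))"
    by (simp add: nn_integral_cmult nn_integral_suminf)
  also have "\<dots> \<le> ennreal (2 powr (p - 1)) * (\<Sum>k. ennreal ((1 / 2) ^ k) *
      ennreal ((32 / \<delta>) powr p * M * (2 * \<delta>) powr (\<gamma> * p)))"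
    by (intro mult_left_mono suminf_le summableI scale) auto
  also have "\<dots> = ennreal (2 powr (p - 1)) * (ennreal 2 * ennreal ((32 / \<delta>) powr p * M * (2 * \<delta>) powr (\<gamma> * p)))"
    by (simp only: ennreal_suminf_multc weights)
  also have "\<dots> = ennreal (2 powr (p - 1) * (2 * ((32 / \<delta>) powr p * M * (2 * \<delta>) powr (\<gamma> * p))))"
    by (simp only: ennreal_mult' powr_ge_zero zero_le_numeral)
  also have "2 powr (p - 1) * (2 * ((32 / \<delta>) powr p * M * (2 * \<delta>) powr (\<gamma> * p)))
      = 2 powr p * (32 / \<delta>) powr p * M * (2 * \<delta>) powr (\<gamma> * p)"
    by (simp add: powr_diff)
  finally show ?thesis unfolding E_def .
qed

section \<open>The near part of the potential\<close>

lemma nn_integral_abs_powr_half: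
  assumes "0 \<le> h"
  shows "(\<integral>\<^sup>+ t. ennreal (\<bar>t\<bar> powr (- (1 / 2))) * indicator {-h..h} t \<partial>lborel) \<le> ennreal (4 * sqrt h)"
proof -
  define g where "g t = ennreal (\<bar>t\<bar> powr (- (1 / 2))) * indicator {0..h} t" for t
  have [measurable]: "g \<in> borel_measurable borel" unfolding g_def by measurable
  have "((\<lambda>x. x powr (- (1 / 2))) has_integral (h powr (- (1 / 2) + 1) / (- (1 / 2) + 1))) {0..h}"
    using assms by (intro has_integral_powr_from_0) auto
  then have "((\<lambda>x. \<bar>x\<bar> powr (- (1 / 2))) has_integral (2 * sqrt h)) {0..h}"
    using assms by (subst has_integral_cong[of _ _ "\<lambda>x. x powr (- (1 / 2))"]) (auto simp: powr_half_sqrt mult.commute)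
  then have g: "(\<integral>\<^sup>+ t. g t \<partial>lborel) = ennreal (2 * sqrt h)"
    unfolding g_def by (intro nn_integral_has_integral_lebesgue'[where f = "\<lambda>x. \<bar>x\<bar> powr (- (1 / 2))"]) auto
  have "(\<integral>\<^sup>+ t. ennreal (\<bar>t\<bar> powr (- (1 / 2))) * indicator {-h..h} t \<partial>lborel) \<le> (\<integral>\<^sup>+ t. g t + g (- t) \<partial>lborel)"
    by (intro nn_integral_mono) (auto simp: g_def indicator_def)
  also have "\<dots> = (\<integral>\<^sup>+ t. g t \<partial>lborel) + (\<integral>\<^sup>+ t. g (0 + (-1) * t) \<partial>lborel)"
    by (subst nn_integral_add) auto
  also have "(\<integral>\<^sup>+ t. g (0 + (-1) * t) \<partial>lborel) = (\<integral>\<^sup>+ t. g t \<partial>lborel)"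
    using nn_integral_real_affine[of g "-1" 0] by simp
  finally show ?thesis using assms by (simp add: g flip: ennreal_plus)
qed

text \<open>The negative power \<open>1 / (2 p)\<close> of the distance dominates the logarithm, so the \<open>p\<close>-th power of the
kernel is at most a multiple of \<open>\<delta>\<^sup>-\<^sup>p (\<delta> / |x|)\<^sup>1\<^sup>/\<^sup>2\<close>, where \<open>x\<close> is the angle between \<open>z\<close> and \<open>\<zeta>\<close>. This is
integrable over \<open>|x| \<le> \<pi> \<delta>\<close> with integral of order \<open>\<delta>\<^sup>1\<^sup>-\<^sup>p\<close>.\<close>

lemma nn_integral_near_disc_kernel_powr_le:
  assumes p: "1 < p" and \<delta>: "0 < \<delta>" "\<delta> \<le> 1 / 2"
  shows "(\<integral>\<^sup>+ \<phi>\<in>{0..2*pi}. ennreal_powr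
      (if norm (of_real (1 - \<delta>) * cis \<phi> - \<zeta>) \<le> \<delta> / 2 then disc_kernel (of_real (1 - \<delta>) * cis \<phi>) \<zeta> else 0) p \<partial>lborel)
    \<le> ennreal (8 * sqrt 6 * pi * (4 * p) powr p * \<delta> powr (1 - p))"
proof -
  define z where "z \<phi> = of_real (1 - \<delta>) * cis \<phi>" for \<phi>
  have nz: "norm (z \<phi>) = 1 - \<delta>" for \<phi>
    using \<delta> unfolding z_def by (intro norm_circle_point) simp
  define c where "c = (4 * p / \<delta>) powr p * sqrt (6 * pi * \<delta>)"
  have c: "0 \<le> c" using \<delta> by (simp add: c_def)
  define s where "s t = ennreal (\<bar>t\<bar> powr (- (1 / 2))) * indicator {-(pi * \<delta>)..pi * \<delta>} t" for t
  have [measurable]: "s \<in> borel_measurable borel" unfolding s_def by measurable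
  have s_int: "(\<integral>\<^sup>+ t. s t \<partial>lborel) \<le> ennreal (4 * sqrt (pi * \<delta>))"
    unfolding s_def using \<delta> by (intro nn_integral_abs_powr_half) auto
  have s_shift: "(\<integral>\<^sup>+ t. s (b - t) \<partial>lborel) = (\<integral>\<^sup>+ t. s t \<partial>lborel)" for b
    using nn_integral_real_affine[of s "-1" b] by simp
  \<comment> \<open>The two exceptional angles are those at which \<open>z\<close> may coincide with \<open>\<zeta>\<close>, where the kernel is
    infinite.\<close>
  have pointwise: "ennreal_powr (if norm (z \<phi> - \<zeta>) \<le> \<delta> / 2 then disc_kernel (z \<phi>) \<zeta> else 0) p * indicator {0..2*pi} \<phi>
      \<le> ennreal c * (s (Arg \<zeta> - \<phi>) + s (Arg \<zeta> + 2 * pi - \<phi>))"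
    if ne: "\<phi> \<noteq> Arg \<zeta>" "\<phi> \<noteq> Arg \<zeta> + 2 * pi" for \<phi>
  proof (cases "norm (z \<phi> - \<zeta>) \<le> \<delta> / 2 \<and> \<phi> \<in> {0..2*pi}")
    case True
    then have near: "norm (z \<phi> - \<zeta>) \<le> \<delta> / 2" and \<phi>: "0 \<le> \<phi>" "\<phi> \<le> 2 * pi" by auto
    have "\<zeta> \<noteq> 0"
      using near nz[of \<phi>] \<delta> by auto
    \<comment> \<open>As \<open>Arg \<zeta> - \<phi>\<close> lies in \<open>[-3 \<pi>, \<pi>]\<close>, at most one full turn is needed to reach \<open>[-\<pi>, \<pi>]\<close>;
      this explains the two translates of \<open>s\<close>.\<close>
    define k :: int where "k = (if - pi \<le> Arg \<zeta> - \<phi> then 0 else 1)"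
    define x where "x = Arg \<zeta> - \<phi> + 2 * pi * of_int k"
    have "\<bar>x\<bar> \<le> pi"
      using \<phi> Arg_bounded[of \<zeta>] by (auto simp: x_def k_def)
    then have "\<bar>x\<bar> \<le> 2 * pi * norm (z \<phi> - \<zeta>)"
      unfolding x_def z_def using \<open>\<zeta> \<noteq> 0\<close> \<delta> by (intro angle_le_norm_diff) auto
    moreover have "x \<noteq> 0"
      using ne by (auto simp: x_def k_def)
    moreover define d where "d = norm (z \<phi> - \<zeta>)"
    ultimately have x: "0 < \<bar>x\<bar>" "\<bar>x\<bar> \<le> 2 * pi * d" by auto
    then have "d \<noteq> 0" by auto
    then have d: "0 < d" by (simp add: d_def)
    have "2 * pi * d \<le> 2 * pi * (\<delta> / 2)" using near d_def by (intro mult_left_mono) auto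
    with x(2) have "\<bar>x\<bar> \<le> 2 * pi * (\<delta> / 2)" by (rule order.trans)
    then have x\<delta>: "\<bar>x\<bar> \<le> pi * \<delta>" by simp
    have "disc_kernel (z \<phi>) \<zeta> \<le> ennreal (2 / (1 / (2 * p) * (1 - norm (z \<phi>))) * (3 * (1 - norm (z \<phi>)) / norm (z \<phi> - \<zeta>)) powr (1 / (2 * p)))"
      using nz near d \<delta> p by (intro disc_kernel_near_le) (auto simp: d_def)
    also have "\<dots> = ennreal (4 * p / \<delta> * (3 * \<delta> / d) powr (1 / (2 * p)))"
      by (simp add: nz d_def)
    finally have "ennreal_powr (disc_kernel (z \<phi>) \<zeta>) p \<le> ennreal_powr (ennreal (4 * p / \<delta> * (3 * \<delta> / d) powr (1 / (2 * p)))) p"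
      using p by (intro ennreal_powr_mono) auto
    also have "\<dots> = ennreal ((4 * p / \<delta>) powr p * (3 * \<delta> / d) powr (1 / 2))"
    proof -
      have "(4 * p / \<delta> * (3 * \<delta> / d) powr (1 / (2 * p))) powr p = (4 * p / \<delta>) powr p * (3 * \<delta> / d) powr (1 / (2 * p) * p)"
        by (simp only: powr_mult powr_powr)
      moreover have "1 / (2 * p) * p = 1 / 2" using p by simp
      ultimately show ?thesis
        using p \<delta> by (subst ennreal_powr_ennreal) auto
    qed
    also have "\<dots> \<le> ennreal ((4 * p / \<delta>) powr p * (6 * pi * \<delta> / \<bar>x\<bar>) powr (1 / 2))"
      using x d \<delta> by (intro ennreal_leI mult_left_mono powr_mono2) (auto simp: field_simps)
    also have "(6 * pi * \<delta> / \<bar>x\<bar>) powr (1 / 2) = sqrt (6 * pi * \<delta>) * \<bar>x\<bar> powr (- (1 / 2))"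
    proof -
      have "(6 * pi * \<delta>) powr (1 / 2) = sqrt (6 * pi * \<delta>)"
        using \<delta> by (intro powr_half_sqrt) auto
      then show ?thesis
        by (simp only: powr_divide powr_minus_divide) simp
    qed
    also have "ennreal ((4 * p / \<delta>) powr p * (sqrt (6 * pi * \<delta>) * \<bar>x\<bar> powr (- (1 / 2)))) = ennreal c * s x"
      using x\<delta> c by (simp add: s_def c_def abs_le_iff mult.assoc flip: ennreal_mult)
    also have "\<dots> \<le> ennreal c * (s (Arg \<zeta> - \<phi>) + s (Arg \<zeta> + 2 * pi - \<phi>))"
      by (intro mult_left_mono) (auto simp: x_def k_def algebra_simps)
    finally show ?thesis using True by simp
  qed auto
  have "(\<integral>\<^sup>+ \<phi>\<in>{0..2*pi}. ennreal_powr (if norm (z \<phi> - \<zeta>) \<le> \<delta> / 2 then disc_kernel (z \<phi>) \<zeta> else 0) p \<partial>lborel)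
      \<le> (\<integral>\<^sup>+ \<phi>. ennreal c * (s (Arg \<zeta> - \<phi>) + s (Arg \<zeta> + 2 * pi - \<phi>)) \<partial>lborel)"
  proof (rule nn_integral_mono_AE)
    show "AE \<phi> in lborel. ennreal_powr (if norm (z \<phi> - \<zeta>) \<le> \<delta> / 2 then disc_kernel (z \<phi>) \<zeta> else 0) p * indicator {0..2*pi} \<phi>
        \<le> ennreal c * (s (Arg \<zeta> - \<phi>) + s (Arg \<zeta> + 2 * pi - \<phi>))"
      using AE_lborel_singleton[of "Arg \<zeta>"] AE_lborel_singleton[of "Arg \<zeta> + 2 * pi"]
      by eventually_elim (rule pointwise)
  qed
  also have "\<dots> = ennreal c * ((\<integral>\<^sup>+ t. s t \<partial>lborel) + (\<integral>\<^sup>+ t. s t \<partial>lborel))"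
    by (simp add: nn_integral_cmult nn_integral_add s_shift)
  also have "\<dots> \<le> ennreal c * (ennreal (4 * sqrt (pi * \<delta>)) + ennreal (4 * sqrt (pi * \<delta>)))"
    by (intro mult_left_mono add_mono s_int) auto
  also have "\<dots> = ennreal (c * (8 * sqrt (pi * \<delta>)))"
    using c \<delta> by (simp flip: ennreal_plus ennreal_mult)
  also have "c * (8 * sqrt (pi * \<delta>)) = 8 * sqrt 6 * pi * (4 * p) powr p * \<delta> powr (1 - p)"
  proof -
    have "sqrt (6 * pi * \<delta>) * sqrt (pi * \<delta>) = sqrt 6 * (sqrt (pi * \<delta>) * sqrt (pi * \<delta>))"
      by (simp only: mult.assoc real_sqrt_mult[of 6])
    also have "sqrt (pi * \<delta>) * sqrt (pi * \<delta>) = pi * \<delta>"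
      using \<delta> by (intro real_sqrt_mult_self[THEN trans]) auto
    finally have roots: "sqrt (6 * pi * \<delta>) * sqrt (pi * \<delta>) = sqrt 6 * (pi * \<delta>)" .
    have "c * (8 * sqrt (pi * \<delta>)) = (4 * p / \<delta>) powr p * (8 * (sqrt (6 * pi * \<delta>) * sqrt (pi * \<delta>)))"
      by (simp only: c_def mult_ac)
    also have "\<dots> = (4 * p / \<delta>) powr p * (8 * (sqrt 6 * (pi * \<delta>)))"
      by (simp only: roots)
    also have "\<dots> = 8 * sqrt 6 * pi * (4 * p) powr p * (\<delta> / \<delta> powr p)"
      by (simp only: powr_divide times_divide_eq_left times_divide_eq_right mult_ac)
    also have "\<delta> / \<delta> powr p = \<delta> powr (1 - p)"
      using \<delta> by (simp only: powr_diff powr_one)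
    finally show ?thesis .
  qed
  finally show ?thesis unfolding z_def .
qed

text \<open>A positive proportion of the angles that the box allows is kept inside \<open>[0, 2\<pi>]\<close>, uniformly in \<open>\<zeta>\<close>: the
interval of admissible angles around the argument of \<open>\<zeta>\<close> may leave \<open>[0, 2\<pi>]\<close>,
but its part towards the middle of \<open>[0, 2\<pi>]\<close> does not.\<close>

lemma angular_extent_ge:
  assumes "0 < \<delta>" "\<delta> \<le> 1 / 2" "1 - 2 * \<delta> \<le> norm \<zeta>" "norm \<zeta> \<le> 1"
  shows "ennreal \<delta> \<le> (\<integral>\<^sup>+ \<phi>\<in>{0..2*pi}. indicator (carleson_box \<phi> (2 * \<delta>)) \<zeta> \<partial>lborel)"
proof -
  define k :: int where "k = (if Arg \<zeta> < 0 then 1 else 0)"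
  define \<theta> where "\<theta> = Arg \<zeta> + 2 * pi * of_int k"
  have \<theta>: "0 \<le> \<theta>" "\<theta> \<le> 2 * pi"
    using Arg_bounded[of \<zeta>] by (auto simp: \<theta>_def k_def)
  define a where "a = (if \<theta> \<le> pi then \<theta> else \<theta> - \<delta>)"
  have "pi > 1" using pi_gt3 by simp
  have "indicator {a..a + \<delta>} \<phi> \<le> indicator (carleson_box \<phi> (2 * \<delta>)) \<zeta> * (indicator {0..2*pi} \<phi> :: ennreal)" for \<phi>
  proof (cases "\<phi> \<in> {a..a + \<delta>}")
    case True
    then have \<phi>: "\<phi> \<in> {0..2*pi}"
      using \<theta> assms \<open>pi > 1\<close> by (auto simp: a_def split: if_splits)
    have "\<bar>Arg \<zeta> - \<phi> + 2 * pi * of_int k\<bar> \<le> 1 * \<delta>"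
      using True assms by (auto simp: a_def \<theta>_def split: if_splits)
    also have "1 * \<delta> \<le> (2 * pi) * \<delta>"
      using \<open>pi > 1\<close> assms by (intro mult_right_mono) auto
    also have "(2 * pi) * \<delta> = pi * (2 * \<delta>)" by simp
    finally have "\<bar>Arg \<zeta> - \<phi> + 2 * pi * of_int k\<bar> \<le> pi * (2 * \<delta>)" .
    then have "\<zeta> \<in> carleson_box \<phi> (2 * \<delta>)"
      using assms by (intro carleson_boxI[where k = k]) auto
    then show ?thesis using True \<phi> by simp
  qed simp
  then have "(\<integral>\<^sup>+ \<phi>. indicator {a..a + \<delta>} \<phi> \<partial>lborel)
      \<le> (\<integral>\<^sup>+ \<phi>\<in>{0..2*pi}. indicator (carleson_box \<phi> (2 * \<delta>)) \<zeta> \<partial>lborel)"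
    by (intro nn_integral_mono)
  then show ?thesis using assms by simp
qed

text \<open>The near part of the potential at \<open>z = (1 - \<delta>) e\<^sup>i\<^sup>\<phi>\<close> only sees the box \<open>C(\<phi>, 2\<delta>)\<close>. Jensen's inequality
on this box bounds its \<open>p\<close>-th power by \<open>\<lambda>(C(\<phi>, 2\<delta>))\<^sup>p\<^sup>-\<^sup>1\<close> times the integral of the \<open>p\<close>-th power of the
kernel. For \<open>\<zeta>\<close> in that box, \<open>C(\<phi>, 2\<delta>) \<subseteq> C(Arg \<zeta>, 4\<delta>)\<close>, so the first factor is dominated by a function
\<open>R\<close> of \<open>\<zeta>\<close> alone and the angle can be integrated out. What remains is \<open>\<delta> \<integral> R d\<lambda>\<close> up to a constant; the
factor \<open>\<delta>\<close> is traded for the set of angles \<open>\<phi>\<close> with \<open>\<zeta>\<close> in \<open>C(\<phi>, 2\<delta>)\<close>, and for these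
\<open>C(Arg \<zeta>, 4\<delta>) \<subseteq> C(\<phi>, 6\<delta>)\<close>, which leads back to a mean of \<open>\<lambda>(C(\<phi>, 6\<delta>))\<^sup>p\<close>.\<close>

lemma near_energy:
  assumes fin: "finite_measure \<Lambda>" and sets [measurable_cong]: "sets \<Lambda> = sets borel"
    and p: "1 < p" and \<delta>: "0 < \<delta>" "\<delta> \<le> 1 / 2"
  shows "(\<integral>\<^sup>+ \<phi>\<in>{0..2*pi}. ennreal_powr (\<integral>\<^sup>+ \<zeta>.
        (if norm (of_real (1 - \<delta>) * cis \<phi> - \<zeta>) \<le> \<delta> / 2 then disc_kernel (of_real (1 - \<delta>) * cis \<phi>) \<zeta> else 0) \<partial>\<Lambda>) p \<partial>lborel)
    \<le> ennreal (8 * sqrt 6 * pi * (4 * p) powr p * \<delta> powr (- p)) * box_energy p \<Lambda> (6 * \<delta>)"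
proof -
  interpret finite_measure \<Lambda> by fact
  interpret pair_sigma_finite lborel \<Lambda> ..
  note [measurable] = borel_measurable_emeasure_carleson_box[OF fin sets]
  define A where "A = 8 * sqrt 6 * pi * (4 * p) powr p"
  have A: "0 \<le> A" by (simp add: A_def)
  define f where "f \<phi> \<zeta> =
      (if norm (of_real (1 - \<delta>) * cis \<phi> - \<zeta>) \<le> \<delta> / 2 then disc_kernel (of_real (1 - \<delta>) * cis \<phi>) \<zeta> else 0)" for \<phi> \<zeta>
  have [measurable]: "(\<lambda>x. f (g x) (h x)) \<in> borel_measurable N"
    if [measurable]: "g \<in> borel_measurable N" "h \<in> borel_measurable N" for g h and N :: "'z measure"
    unfolding f_def by measurable
  have f_box: "\<zeta> \<in> carleson_box \<phi> (2 * \<delta>)" if "f \<phi> \<zeta> \<noteq> 0" for \<phi> \<zeta>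
  proof -
    have "norm \<zeta> \<le> 1" "norm (of_real (1 - \<delta>) * cis \<phi> - \<zeta>) \<le> \<delta> / 2"
      using that by (auto simp: f_def disc_kernel_def split: if_splits)
    then show ?thesis
      using near_imp_carleson_box[of \<delta> \<zeta> "\<delta> / 2" \<phi>] \<delta> by simp
  qed
  define R where "R \<zeta> = ennreal_powr (emeasure \<Lambda> (carleson_box (Arg \<zeta>) (4 * \<delta>))) (p - 1)
      * indicator {\<zeta>. 1 - 2 * \<delta> \<le> norm \<zeta> \<and> norm \<zeta> \<le> 1} \<zeta>" for \<zeta>
  have [measurable]: "R \<in> borel_measurable borel"
    unfolding R_def by measurable
  have Jensen: "ennreal_powr (\<integral>\<^sup>+ \<zeta>. f \<phi> \<zeta> \<partial>\<Lambda>) p \<le> (\<integral>\<^sup>+ \<zeta>. R \<zeta> * ennreal_powr (f \<phi> \<zeta>) p \<partial>\<Lambda>)" for \<phi>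
  proof -
    define B where "B = carleson_box \<phi> (2 * \<delta>)"
    have [measurable, simp]: "B \<in> sets borel" by (simp add: B_def)
    have f_eq: "indicator B \<zeta> * f \<phi> \<zeta> = f \<phi> \<zeta>" for \<zeta>
      using f_box[of \<phi> \<zeta>] by (cases "f \<phi> \<zeta> = 0") (auto simp: B_def)
    have mass: "(\<integral>\<^sup>+ \<zeta>. indicator B \<zeta> \<partial>\<Lambda>) = emeasure \<Lambda> B"
      by (simp add: sets)
    have "ennreal_powr (\<integral>\<^sup>+ \<zeta>. indicator B \<zeta> * f \<phi> \<zeta> \<partial>\<Lambda>) p
        \<le> ennreal_powr (\<integral>\<^sup>+ \<zeta>. indicator B \<zeta> \<partial>\<Lambda>) (p - 1)
          * (\<integral>\<^sup>+ \<zeta>. indicator B \<zeta> * ennreal_powr (f \<phi> \<zeta>) p \<partial>\<Lambda>)"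
      using emeasure_finite[of B] p by (intro nn_integral_powr_Jensen) (auto simp: mass less_top[symmetric])
    also have "\<dots> = (\<integral>\<^sup>+ \<zeta>. ennreal_powr (emeasure \<Lambda> B) (p - 1) * (indicator B \<zeta> * ennreal_powr (f \<phi> \<zeta>) p) \<partial>\<Lambda>)"
      unfolding mass by (subst nn_integral_cmult) auto
    also have "\<dots> \<le> (\<integral>\<^sup>+ \<zeta>. R \<zeta> * ennreal_powr (f \<phi> \<zeta>) p \<partial>\<Lambda>)"
    proof (intro nn_integral_mono)
      fix \<zeta>
      show "ennreal_powr (emeasure \<Lambda> B) (p - 1) * (indicator B \<zeta> * ennreal_powr (f \<phi> \<zeta>) p) \<le> R \<zeta> * ennreal_powr (f \<phi> \<zeta>) p"
      proof (cases "\<zeta> \<in> B")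
        case True
        then have "B \<subseteq> carleson_box (Arg \<zeta>) (4 * \<delta>)"
          using carleson_box_recentre[of \<zeta> \<phi> "2 * \<delta>" _ "2 * \<delta>"] \<delta> by (auto simp: B_def)
        then have "ennreal_powr (emeasure \<Lambda> B) (p - 1) \<le> ennreal_powr (emeasure \<Lambda> (carleson_box (Arg \<zeta>) (4 * \<delta>))) (p - 1)"
          using p by (intro ennreal_powr_mono emeasure_mono) (auto simp: sets)
        moreover have "1 - 2 * \<delta> \<le> norm \<zeta> \<and> norm \<zeta> \<le> 1"
          using True by (auto simp: B_def elim: carleson_boxE)
        ultimately show ?thesis
          using True by (auto simp: R_def intro!: mult_right_mono)
      qed simp
    qed
    finally show ?thesis by (simp only: f_eq)
  qed
  \<comment> \<open>The surplus factor \<open>\<delta>\<close> is spread over the angles whose box contains \<open>\<zeta>\<close>.\<close>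
  have smear: "ennreal (A * \<delta> powr (1 - p)) * R \<zeta>
      \<le> (\<integral>\<^sup>+ \<phi>. ennreal (A * \<delta> powr (- p)) * (R \<zeta> * (indicator (carleson_box \<phi> (2 * \<delta>)) \<zeta> * indicator {0..2*pi} \<phi>)) \<partial>lborel)" for \<zeta>
  proof (cases "R \<zeta> = 0")
    case False
    then have "1 - 2 * \<delta> \<le> norm \<zeta>" "norm \<zeta> \<le> 1" by (auto simp: R_def indicator_def split: if_splits)
    then have "ennreal \<delta> \<le> (\<integral>\<^sup>+ \<phi>\<in>{0..2*pi}. indicator (carleson_box \<phi> (2 * \<delta>)) \<zeta> \<partial>lborel)"
      using \<delta> by (intro angular_extent_ge) auto
    then have "ennreal (A * \<delta> powr (- p)) * (R \<zeta> * ennreal \<delta>) \<le>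
        ennreal (A * \<delta> powr (- p)) * (R \<zeta> * (\<integral>\<^sup>+ \<phi>\<in>{0..2*pi}. indicator (carleson_box \<phi> (2 * \<delta>)) \<zeta> \<partial>lborel))"
      by (intro mult_left_mono) auto
    also have "\<dots> = (\<integral>\<^sup>+ \<phi>. ennreal (A * \<delta> powr (- p)) * (R \<zeta> * (indicator (carleson_box \<phi> (2 * \<delta>)) \<zeta> * indicator {0..2*pi} \<phi>)) \<partial>lborel)"
      by (simp add: nn_integral_cmult)
    also have "ennreal (A * \<delta> powr (- p)) * (R \<zeta> * ennreal \<delta>) = ennreal (A * \<delta> powr (- p) * \<delta>) * R \<zeta>"
      using A \<delta> by (simp add: ennreal_mult mult_ac)
    also have "A * \<delta> powr (- p) * \<delta> = A * \<delta> powr (1 - p)"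
      using \<delta> powr_add[of \<delta> "- p" 1] by simp
    finally show ?thesis .
  qed simp
  \<comment> \<open>Integrating \<open>R\<close> over the box itself restores the missing power of the measure.\<close>
  have unsmear: "(\<integral>\<^sup>+ \<zeta>. R \<zeta> * indicator (carleson_box \<phi> (2 * \<delta>)) \<zeta> \<partial>\<Lambda>) \<le> ennreal_powr (emeasure \<Lambda> (carleson_box \<phi> (6 * \<delta>))) p" for \<phi>
  proof -
    define E where "E = emeasure \<Lambda> (carleson_box \<phi> (6 * \<delta>))"
    have "(\<integral>\<^sup>+ \<zeta>. R \<zeta> * indicator (carleson_box \<phi> (2 * \<delta>)) \<zeta> \<partial>\<Lambda>)
        \<le> (\<integral>\<^sup>+ \<zeta>. ennreal_powr E (p - 1) * indicator (carleson_box \<phi> (2 * \<delta>)) \<zeta> \<partial>\<Lambda>)"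
    proof (intro nn_integral_mono)
      fix \<zeta>
      show "R \<zeta> * indicator (carleson_box \<phi> (2 * \<delta>)) \<zeta> \<le> ennreal_powr E (p - 1) * indicator (carleson_box \<phi> (2 * \<delta>)) \<zeta>"
      proof (cases "\<zeta> \<in> carleson_box \<phi> (2 * \<delta>)")
        case True
        then have "carleson_box (Arg \<zeta>) (4 * \<delta>) \<subseteq> carleson_box \<phi> (6 * \<delta>)"
          using carleson_box_trans[of \<zeta> \<phi> "2 * \<delta>" _ "4 * \<delta>"] \<delta> by auto
        then have "ennreal_powr (emeasure \<Lambda> (carleson_box (Arg \<zeta>) (4 * \<delta>))) (p - 1) \<le> ennreal_powr E (p - 1)"
          unfolding E_def using p by (intro ennreal_powr_mono emeasure_mono) (auto simp: sets)
        then show ?thesis by (auto simp: R_def indicator_def)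
      qed simp
    qed
    also have "\<dots> = ennreal_powr E (p - 1) * emeasure \<Lambda> (carleson_box \<phi> (2 * \<delta>))"
      by (simp add: nn_integral_cmult_indicator sets)
    also have "\<dots> \<le> ennreal_powr E (p - 1) * E"
      unfolding E_def using \<delta> by (intro mult_left_mono emeasure_mono carleson_box_mono) (auto simp: sets)
    also have "\<dots> = ennreal_powr E p"
      using p by (intro ennreal_powr_minus_one_mult) auto
    finally show ?thesis by (simp add: E_def)
  qed
  have "(\<integral>\<^sup>+ \<phi>\<in>{0..2*pi}. ennreal_powr (\<integral>\<^sup>+ \<zeta>. f \<phi> \<zeta> \<partial>\<Lambda>) p \<partial>lborel)
      \<le> (\<integral>\<^sup>+ \<phi>\<in>{0..2*pi}. (\<integral>\<^sup>+ \<zeta>. R \<zeta> * ennreal_powr (f \<phi> \<zeta>) p \<partial>\<Lambda>) \<partial>lborel)"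
    by (intro nn_integral_mono mult_right_mono Jensen) auto
  also have "\<dots> = (\<integral>\<^sup>+ \<phi>. (\<integral>\<^sup>+ \<zeta>. R \<zeta> * (ennreal_powr (f \<phi> \<zeta>) p * indicator {0..2*pi} \<phi>) \<partial>\<Lambda>) \<partial>lborel)"
    by (simp add: nn_integral_multc[symmetric] mult.assoc)
  also have "\<dots> = (\<integral>\<^sup>+ \<zeta>. (\<integral>\<^sup>+ \<phi>. R \<zeta> * (ennreal_powr (f \<phi> \<zeta>) p * indicator {0..2*pi} \<phi>) \<partial>lborel) \<partial>\<Lambda>)"
    by (rule Fubini'[symmetric]) measurable
  also have "\<dots> = (\<integral>\<^sup>+ \<zeta>. R \<zeta> * (\<integral>\<^sup>+ \<phi>\<in>{0..2*pi}. ennreal_powr (f \<phi> \<zeta>) p \<partial>lborel) \<partial>\<Lambda>)"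
    by (simp add: nn_integral_cmult)
  also have "\<dots> \<le> (\<integral>\<^sup>+ \<zeta>. R \<zeta> * ennreal (A * \<delta> powr (1 - p)) \<partial>\<Lambda>)"
    unfolding f_def A_def by (intro nn_integral_mono mult_left_mono nn_integral_near_disc_kernel_powr_le p \<delta>) auto
  also have "\<dots> \<le> (\<integral>\<^sup>+ \<zeta>. (\<integral>\<^sup>+ \<phi>. ennreal (A * \<delta> powr (- p)) * (R \<zeta> * (indicator (carleson_box \<phi> (2 * \<delta>)) \<zeta> * indicator {0..2*pi} \<phi>)) \<partial>lborel) \<partial>\<Lambda>)"
    using smear by (intro nn_integral_mono) (simp add: mult.commute)
  also have "\<dots> = (\<integral>\<^sup>+ \<phi>. (\<integral>\<^sup>+ \<zeta>. ennreal (A * \<delta> powr (- p)) * (R \<zeta> * (indicator (carleson_box \<phi> (2 * \<delta>)) \<zeta> * indicator {0..2*pi} \<phi>)) \<partial>\<Lambda>) \<partial>lborel)"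
    by (rule Fubini') measurable
  also have "\<dots> = (\<integral>\<^sup>+ \<phi>. ennreal (A * \<delta> powr (- p)) * ((\<integral>\<^sup>+ \<zeta>. R \<zeta> * indicator (carleson_box \<phi> (2 * \<delta>)) \<zeta> \<partial>\<Lambda>) * indicator {0..2*pi} \<phi>) \<partial>lborel)"
  proof (intro nn_integral_cong)
    fix \<phi>
    have "(\<integral>\<^sup>+ \<zeta>. R \<zeta> * (indicator (carleson_box \<phi> (2 * \<delta>)) \<zeta> * indicator {0..2*pi} \<phi>) \<partial>\<Lambda>)
        = (\<integral>\<^sup>+ \<zeta>. R \<zeta> * indicator (carleson_box \<phi> (2 * \<delta>)) \<zeta> \<partial>\<Lambda>) * indicator {0..2*pi} \<phi>"
      by (subst nn_integral_multc[symmetric]) (auto simp: mult.assoc)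
    then show "(\<integral>\<^sup>+ \<zeta>. ennreal (A * \<delta> powr (- p)) * (R \<zeta> * (indicator (carleson_box \<phi> (2 * \<delta>)) \<zeta> * indicator {0..2*pi} \<phi>)) \<partial>\<Lambda>)
        = ennreal (A * \<delta> powr (- p)) * ((\<integral>\<^sup>+ \<zeta>. R \<zeta> * indicator (carleson_box \<phi> (2 * \<delta>)) \<zeta> \<partial>\<Lambda>) * indicator {0..2*pi} \<phi>)"
      by (subst nn_integral_cmult) auto
  qed
  also have "\<dots> \<le> (\<integral>\<^sup>+ \<phi>. ennreal (A * \<delta> powr (- p)) * (ennreal_powr (emeasure \<Lambda> (carleson_box \<phi> (6 * \<delta>))) p * indicator {0..2*pi} \<phi>) \<partial>lborel)"
    by (intro nn_integral_mono mult_left_mono mult_right_mono unsmear) auto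
  also have "\<dots> = ennreal (A * \<delta> powr (- p)) * box_energy p \<Lambda> (6 * \<delta>)"
    unfolding box_energy_def by (simp add: nn_integral_cmult)
  finally show ?thesis unfolding f_def A_def .
qed

section \<open>Means of the potential and means over boxes\<close>

definition circle_energy :: "real \<Rightarrow> complex measure \<Rightarrow> real \<Rightarrow> ennreal" where
  "circle_energy p \<Lambda> \<delta> =
     (\<integral>\<^sup>+ \<phi>\<in>{0..2*pi}. ennreal_powr (disc_potential \<Lambda> (of_real (1 - \<delta>) * cis \<phi>)) p \<partial>lborel)"

lemma box_energy_le_circle_energy:
  assumes fin: "finite_measure \<Lambda>" and sets [measurable_cong]: "sets \<Lambda> = sets borel"
    and p: "0 < p" and \<delta>: "0 < \<delta>" "\<delta> < 1"
  shows "box_energy p \<Lambda> \<delta> \<le> ennreal ((72 * pi * \<delta>) powr p) * circle_energy p \<Lambda> \<delta>"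
proof -
  note [measurable] = borel_measurable_disc_potential[OF fin sets]
  have "ennreal_powr (emeasure \<Lambda> (carleson_box \<phi> \<delta>)) p
      \<le> ennreal ((72 * pi * \<delta>) powr p) * ennreal_powr (disc_potential \<Lambda> (of_real (1 - \<delta>) * cis \<phi>)) p" for \<phi>
  proof -
    have "ennreal_powr (emeasure \<Lambda> (carleson_box \<phi> \<delta>)) p
        \<le> ennreal_powr (ennreal (72 * pi * \<delta>) * disc_potential \<Lambda> (of_real (1 - \<delta>) * cis \<phi>)) p"
      using p \<delta> sets by (intro ennreal_powr_mono emeasure_carleson_box_le_potential) auto
    then show ?thesis
      using p \<delta> by (simp add: ennreal_powr_mult ennreal_powr_ennreal)
  qed
  then have "box_energy p \<Lambda> \<delta> \<le> (\<integral>\<^sup>+ \<phi>. ennreal ((72 * pi * \<delta>) powr p)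
      * (ennreal_powr (disc_potential \<Lambda> (of_real (1 - \<delta>) * cis \<phi>)) p * indicator {0..2*pi} \<phi>) \<partial>lborel)"
    unfolding box_energy_def
    by (intro nn_integral_mono) (auto simp: indicator_def)
  also have "\<dots> = ennreal ((72 * pi * \<delta>) powr p) * circle_energy p \<Lambda> \<delta>"
    unfolding circle_energy_def by (rule nn_integral_cmult) measurable
  finally show ?thesis .
qed

text \<open>Both parts of the potential scale alike: each contributes \<open>\<delta>\<^sup>-\<^sup>p\<close> times the assumed bound for the energy
of boxes of size comparable to \<open>\<delta>\<close>, and \<open>\<delta>\<^sup>-\<^sup>p \<delta>\<^sup>\<gamma>\<^sup>p\<close> is the power in the claim.\<close>

lemma circle_energy_le:
  assumes fin: "finite_measure \<Lambda>" and sets [measurable_cong]: "sets \<Lambda> = sets borel"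
    and p: "1 < p" and \<gamma>: "\<gamma> \<le> 1" and \<delta>: "0 < \<delta>" "\<delta> \<le> 1 / 2" and M: "0 \<le> M"
    and energy: "\<And>s. 0 < s \<Longrightarrow> box_energy p \<Lambda> s \<le> ennreal (M * s powr (\<gamma> * p))"
  shows "circle_energy p \<Lambda> \<delta> \<le> ennreal (2 powr p * (8 * sqrt 6 * pi * (4 * p) powr p * (M * 6 powr (\<gamma> * p))
      + 2 powr p * 32 powr p * M * 2 powr (\<gamma> * p)) * \<delta> powr ((\<gamma> - 1) * p))"
proof -
  interpret finite_measure \<Lambda> by fact
  note [measurable] = borel_measurable_emeasure_carleson_box[OF fin sets]
  define z where "z \<phi> = of_real (1 - \<delta>) * cis \<phi>" for \<phi>
  have [measurable]: "z \<in> borel_measurable borel" unfolding z_def by measurable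
  define near where "near \<phi> = (\<integral>\<^sup>+ \<zeta>. (if norm (z \<phi> - \<zeta>) \<le> \<delta> / 2 then disc_kernel (z \<phi>) \<zeta> else 0) \<partial>\<Lambda>)" for \<phi>
  have [measurable]: "near \<in> borel_measurable borel"
    unfolding near_def by measurable
  define far where "far \<phi> = (\<Sum>k. ennreal (32 / \<delta> * (1 / 4) ^ k) * emeasure \<Lambda> (carleson_box \<phi> (2 ^ Suc k * \<delta>)))" for \<phi>
  have [measurable]: "far \<in> borel_measurable borel"
    unfolding far_def by measurable
  have split: "disc_potential \<Lambda> (z \<phi>) \<le> near \<phi> + far \<phi>" for \<phi>
  proof -
    define g where "g \<zeta> = (\<Sum>k. ennreal (32 / \<delta> * (1 / 4) ^ k) * indicator (carleson_box \<phi> (2 ^ Suc k * \<delta>)) \<zeta>)" for \<zeta>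
    have [measurable]: "g \<in> borel_measurable borel" unfolding g_def by measurable
    have "disc_potential \<Lambda> (z \<phi>) \<le> (\<integral>\<^sup>+ \<zeta>. (if norm (z \<phi> - \<zeta>) \<le> \<delta> / 2 then disc_kernel (z \<phi>) \<zeta> else 0) + g \<zeta> \<partial>\<Lambda>)"
      unfolding disc_potential_def
    proof (intro nn_integral_mono)
      fix \<zeta>
      show "disc_kernel (z \<phi>) \<zeta> \<le> (if norm (z \<phi> - \<zeta>) \<le> \<delta> / 2 then disc_kernel (z \<phi>) \<zeta> else 0) + g \<zeta>"
        using disc_kernel_far_le[OF \<delta>, of "z \<phi>" \<phi> \<zeta>] by (auto simp: z_def g_def not_le)
    qed
    also have "\<dots> = near \<phi> + (\<integral>\<^sup>+ \<zeta>. g \<zeta> \<partial>\<Lambda>)"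
      unfolding near_def by (rule nn_integral_add) measurable
    also have "(\<integral>\<^sup>+ \<zeta>. g \<zeta> \<partial>\<Lambda>) = far \<phi>"
      unfolding g_def far_def
      by (subst nn_integral_suminf) (auto simp: nn_integral_cmult_indicator sets)
    finally show ?thesis .
  qed
  define q where "q = (\<gamma> - 1) * p"
  have scale1: "\<delta> powr (- p) * (6 * \<delta>) powr (\<gamma> * p) = 6 powr (\<gamma> * p) * \<delta> powr q"
    and scale2: "(32 / \<delta>) powr p * (2 * \<delta>) powr (\<gamma> * p) = 32 powr p * 2 powr (\<gamma> * p) * \<delta> powr q"
  proof -
    have "\<delta> powr q = \<delta> powr (- p) * \<delta> powr (\<gamma> * p)"
      unfolding powr_add[symmetric] by (simp add: q_def algebra_simps)
    then show "\<delta> powr (- p) * (6 * \<delta>) powr (\<gamma> * p) = 6 powr (\<gamma> * p) * \<delta> powr q"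
      and "(32 / \<delta>) powr p * (2 * \<delta>) powr (\<gamma> * p) = 32 powr p * 2 powr (\<gamma> * p) * \<delta> powr q"
      by (simp_all add: powr_mult powr_divide powr_minus_divide)
  qed
  define A where "A = 8 * sqrt 6 * pi * (4 * p) powr p"
  have A: "0 \<le> A" by (simp add: A_def)
  have near: "(\<integral>\<^sup>+ \<phi>\<in>{0..2*pi}. ennreal_powr (near \<phi>) p \<partial>lborel) \<le> ennreal (A * (M * 6 powr (\<gamma> * p)) * \<delta> powr q)"
  proof -
    have "(\<integral>\<^sup>+ \<phi>\<in>{0..2*pi}. ennreal_powr (near \<phi>) p \<partial>lborel)
        \<le> ennreal (A * \<delta> powr (- p)) * box_energy p \<Lambda> (6 * \<delta>)"
      unfolding near_def z_def A_def by (rule near_energy[OF fin sets p \<delta>])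
    also have "\<dots> \<le> ennreal (A * \<delta> powr (- p)) * ennreal (M * (6 * \<delta>) powr (\<gamma> * p))"
      using \<delta> by (intro mult_left_mono energy) auto
    also have "\<dots> = ennreal (A * M * (\<delta> powr (- p) * (6 * \<delta>) powr (\<gamma> * p)))"
      using A M by (simp add: mult_ac flip: ennreal_mult)
    also have "A * M * (\<delta> powr (- p) * (6 * \<delta>) powr (\<gamma> * p)) = A * (M * 6 powr (\<gamma> * p)) * \<delta> powr q"
      unfolding scale1 by simp
    finally show ?thesis .
  qed
  have far: "(\<integral>\<^sup>+ \<phi>\<in>{0..2*pi}. ennreal_powr (far \<phi>) p \<partial>lborel)
      \<le> ennreal (2 powr p * 32 powr p * M * 2 powr (\<gamma> * p) * \<delta> powr q)"
  proof -
    have "(\<integral>\<^sup>+ \<phi>\<in>{0..2*pi}. ennreal_powr (far \<phi>) p \<partial>lborel)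
        \<le> ennreal (2 powr p * (32 / \<delta>) powr p * M * (2 * \<delta>) powr (\<gamma> * p))"
      unfolding far_def by (rule far_sum_energy[OF fin sets p \<gamma> \<delta>(1) M energy])
    also have "2 powr p * (32 / \<delta>) powr p * M * (2 * \<delta>) powr (\<gamma> * p)
        = 2 powr p * M * ((32 / \<delta>) powr p * (2 * \<delta>) powr (\<gamma> * p))"
      by (simp only: mult_ac)
    also have "\<dots> = 2 powr p * 32 powr p * M * 2 powr (\<gamma> * p) * \<delta> powr q"
      unfolding scale2 by (simp only: mult_ac)
    finally show ?thesis .
  qed
  have "circle_energy p \<Lambda> \<delta> \<le> (\<integral>\<^sup>+ \<phi>. ennreal (2 powr p) *
      (ennreal_powr (near \<phi>) p * indicator {0..2*pi} \<phi> + ennreal_powr (far \<phi>) p * indicator {0..2*pi} \<phi>) \<partial>lborel)"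
    unfolding circle_energy_def z_def[symmetric]
  proof (intro nn_integral_mono)
    fix \<phi>
    have "ennreal_powr (disc_potential \<Lambda> (z \<phi>)) p \<le> ennreal_powr (near \<phi> + far \<phi>) p"
      using split p by (intro ennreal_powr_mono) auto
    also have "\<dots> \<le> ennreal (2 powr p) * (ennreal_powr (near \<phi>) p + ennreal_powr (far \<phi>) p)"
      using p by (intro ennreal_powr_add_le) auto
    finally show "ennreal_powr (disc_potential \<Lambda> (z \<phi>)) p * indicator {0..2*pi} \<phi> \<le> ennreal (2 powr p) *
      (ennreal_powr (near \<phi>) p * indicator {0..2*pi} \<phi> + ennreal_powr (far \<phi>) p * indicator {0..2*pi} \<phi>)"
      by (auto simp: indicator_def)
  qed
  also have "\<dots> = ennreal (2 powr p) * ((\<integral>\<^sup>+ \<phi>\<in>{0..2*pi}. ennreal_powr (near \<phi>) p \<partial>lborel)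
      + (\<integral>\<^sup>+ \<phi>\<in>{0..2*pi}. ennreal_powr (far \<phi>) p \<partial>lborel))"
    by (simp add: nn_integral_cmult nn_integral_add)
  also have "\<dots> \<le> ennreal (2 powr p) * (ennreal (A * (M * 6 powr (\<gamma> * p)) * \<delta> powr q)
      + ennreal (2 powr p * 32 powr p * M * 2 powr (\<gamma> * p) * \<delta> powr q))"
    by (intro mult_left_mono add_mono near far) auto
  also have "\<dots> = ennreal (2 powr p * (A * (M * 6 powr (\<gamma> * p)) * \<delta> powr q
      + 2 powr p * 32 powr p * M * 2 powr (\<gamma> * p) * \<delta> powr q))"
    using A M by (simp flip: ennreal_mult ennreal_plus)
  finally show ?thesis
    by (simp add: A_def q_def distrib_left distrib_right mult.assoc)
qed

lemma box_energy_bounded: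
  assumes "finite_measure \<Lambda>" and sets: "sets \<Lambda> = sets borel" and p: "0 < p"
  shows "\<exists>E\<ge>0. \<forall>s. box_energy p \<Lambda> s \<le> ennreal E"
proof -
  interpret finite_measure \<Lambda> by fact
  have "box_energy p \<Lambda> s \<le> ennreal (2 * pi * measure \<Lambda> UNIV powr p)" for s
  proof -
    have "box_energy p \<Lambda> s \<le> (\<integral>\<^sup>+ \<phi>. ennreal (measure \<Lambda> UNIV powr p) * indicator {0..2*pi} \<phi> \<partial>lborel)"
      unfolding box_energy_def
    proof (intro nn_integral_mono mult_right_mono)
      fix \<phi>
      have "ennreal_powr (emeasure \<Lambda> (carleson_box \<phi> s)) p \<le> ennreal_powr (emeasure \<Lambda> UNIV) p"
        using p by (intro ennreal_powr_mono emeasure_mono) (auto simp: sets)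
      then show "ennreal_powr (emeasure \<Lambda> (carleson_box \<phi> s)) p \<le> ennreal (measure \<Lambda> UNIV powr p)"
        by (simp add: emeasure_eq_measure ennreal_powr_ennreal)
    qed auto
    also have "\<dots> = ennreal (measure \<Lambda> UNIV powr p) * ennreal (2 * pi)"
      by (subst nn_integral_cmult_indicator) auto
    also have "\<dots> = ennreal (2 * pi * measure \<Lambda> UNIV powr p)"
      by (simp add: mult.commute flip: ennreal_mult)
    finally show ?thesis .
  qed
  then show ?thesis by (intro exI[of _ "2 * pi * measure \<Lambda> UNIV powr p"]) auto
qed

text \<open>For a finite measure the energies of boxes are bounded, so a power bound with nonnegative exponent for
small boxes holds for boxes of any size.\<close>

lemma box_energy_extend:
  assumes fin: "finite_measure \<Lambda>" and sets: "sets \<Lambda> = sets borel" and p: "0 < p"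
    and q: "0 \<le> q" and \<eta>: "0 < \<eta>" and M: "0 \<le> M"
    and small: "\<And>s. 0 < s \<Longrightarrow> s < \<eta> \<Longrightarrow> box_energy p \<Lambda> s \<le> ennreal (M * s powr q)"
  shows "\<exists>M\<ge>0. \<forall>s>0. box_energy p \<Lambda> s \<le> ennreal (M * s powr q)"
proof -
  obtain E where E: "0 \<le> E" "\<And>s. box_energy p \<Lambda> s \<le> ennreal E"
    using box_energy_bounded[OF fin sets p] by blast
  have "box_energy p \<Lambda> s \<le> ennreal ((M + E / \<eta> powr q) * s powr q)" if s: "0 < s" for s
  proof (cases "s < \<eta>")
    case True
    have "box_energy p \<Lambda> s \<le> ennreal (M * s powr q)" by (rule small[OF s True])
    also have "\<dots> \<le> ennreal ((M + E / \<eta> powr q) * s powr q)"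
      using E by (intro ennreal_leI mult_right_mono) auto
    finally show ?thesis .
  next
    case False
    have "E * \<eta> powr q \<le> E * s powr q"
      using False \<eta> q E by (intro mult_left_mono powr_mono2) auto
    then have "E \<le> E / \<eta> powr q * s powr q"
      using \<eta> by (simp add: field_simps)
    also have "\<dots> \<le> (M + E / \<eta> powr q) * s powr q"
      using M by (intro mult_right_mono) auto
    finally show ?thesis
      using E(2)[of s] by (meson ennreal_leI order.trans)
  qed
  moreover have "0 \<le> M + E / \<eta> powr q" using M E by simp
  ultimately show ?thesis by blast
qed

lemma circle_energy_growth_iff_box_energy_growth:
  assumes fin: "finite_measure \<Lambda>" and sets: "sets \<Lambda> = sets borel"
    and p: "1 < p" and \<gamma>: "0 < \<gamma>" "\<gamma> \<le> 1"
  shows "(\<exists>M\<ge>0. \<exists>\<eta>>0. \<forall>\<delta>\<in>{0<..<\<eta>}. circle_energy p \<Lambda> \<delta> \<le> ennreal (M * \<delta> powr ((\<gamma> - 1) * p)))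
    \<longleftrightarrow> (\<exists>M\<ge>0. \<forall>\<delta>>0. box_energy p \<Lambda> \<delta> \<le> ennreal (M * \<delta> powr (\<gamma> * p)))"
    (is "?circle \<longleftrightarrow> ?box")
proof
  assume ?circle
  then obtain M \<eta> where M: "0 \<le> M" and \<eta>: "0 < \<eta>"
    and circle: "\<And>\<delta>. 0 < \<delta> \<Longrightarrow> \<delta> < \<eta> \<Longrightarrow> circle_energy p \<Lambda> \<delta> \<le> ennreal (M * \<delta> powr ((\<gamma> - 1) * p))"
    by auto
  have "box_energy p \<Lambda> s \<le> ennreal ((72 * pi) powr p * M * s powr (\<gamma> * p))" if s: "0 < s" "s < min \<eta> 1" for s
  proof -
    have "box_energy p \<Lambda> s \<le> ennreal ((72 * pi * s) powr p) * circle_energy p \<Lambda> s"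
      using p s by (intro box_energy_le_circle_energy fin sets) auto
    also have "\<dots> \<le> ennreal ((72 * pi * s) powr p) * ennreal (M * s powr ((\<gamma> - 1) * p))"
      using s by (intro mult_left_mono circle) auto
    also have "\<dots> = ennreal ((72 * pi) powr p * M * (s powr p * s powr ((\<gamma> - 1) * p)))"
      using M by (simp add: powr_mult mult_ac flip: ennreal_mult)
    also have "s powr p * s powr ((\<gamma> - 1) * p) = s powr (\<gamma> * p)"
      unfolding powr_add[symmetric] by (simp add: algebra_simps)
    finally show ?thesis .
  qed
  then show ?box
    using p \<gamma> \<eta> M by (intro box_energy_extend[where \<eta> = "min \<eta> 1" and M = "(72 * pi) powr p * M"] fin sets) auto
next
  assume ?box
  then obtain M where M: "0 \<le> M" "\<And>s. 0 < s \<Longrightarrow> box_energy p \<Lambda> s \<le> ennreal (M * s powr (\<gamma> * p))"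
    by auto
  define M' where "M' = 2 powr p * (8 * sqrt 6 * pi * (4 * p) powr p * (M * 6 powr (\<gamma> * p))
      + 2 powr p * 32 powr p * M * 2 powr (\<gamma> * p))"
  have "0 \<le> M'" using M by (simp add: M'_def)
  moreover have "circle_energy p \<Lambda> \<delta> \<le> ennreal (M' * \<delta> powr ((\<gamma> - 1) * p))" if "0 < \<delta>" "\<delta> < 1 / 2" for \<delta>
    unfolding M'_def using that M by (intro circle_energy_le fin sets p \<gamma>) auto
  ultimately show ?circle
    by (intro exI[of _ M'] conjI exI[of _ "1 / 2 :: real"]) auto
qed

section \<open>From the complete measure to a potential\<close>

lemma measurable_restricted_borel:
  assumes "sets \<mu> = sets (restrict_space borel S)" "f \<in> borel_measurable borel"
  shows "f \<in> borel_measurable \<mu>"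
  unfolding measurable_cong_sets[OF assms(1) refl] by (rule measurable_restrict_space1[OF assms(2)])

lemma space_restricted_borel:
  "sets \<mu> = sets (restrict_space borel S) \<Longrightarrow> space \<mu> = S"
  by (drule sets_eq_imp_space_eq) (simp add: space_restrict_space)

text \<open>The set function that defines the complete measure is the sum of a measure with density \<open>1 - |\<zeta>|\<close>
with respect to \<open>\<mu>\<close> and of \<open>\<psi>\<close>; integrals inherit this decomposition by the standard machinery from
indicators to nonnegative functions.\<close>

lemma nn_integral_complete_measure:
  fixes \<mu> \<psi> \<Lambda> :: "complex measure"
  assumes \<mu>: "sets \<mu> = sets (restrict_space borel (ball 0 1))"
    and \<psi>: "sets \<psi> = sets (restrict_space borel (sphere 0 1))"
    and \<Lambda>: "sets \<Lambda> = sets borel"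
    and emeasure: "\<And>A. A \<in> sets borel \<Longrightarrow> emeasure \<Lambda> A =
        (\<integral>\<^sup>+ \<zeta>. indicator A \<zeta> * ennreal (1 - norm \<zeta>) \<partial>\<mu>) + emeasure \<psi> (A \<inter> sphere 0 1)"
    and f: "f \<in> borel_measurable borel"
  shows "(\<integral>\<^sup>+ \<zeta>. f \<zeta> \<partial>\<Lambda>) = (\<integral>\<^sup>+ \<zeta>. f \<zeta> * ennreal (1 - norm \<zeta>) \<partial>\<mu>) + (\<integral>\<^sup>+ \<zeta>. f \<zeta> \<partial>\<psi>)"
proof -
  have m\<mu>: "g \<in> borel_measurable \<mu>" and m\<psi>: "g \<in> borel_measurable \<psi>" and m\<Lambda>: "g \<in> borel_measurable \<Lambda>"
    if "g \<in> borel_measurable borel" for g :: "complex \<Rightarrow> ennreal"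
    using that by (auto intro: measurable_restricted_borel[OF \<mu>] measurable_restricted_borel[OF \<psi>]
        simp: measurable_cong_sets[OF \<Lambda> refl])
  have weight: "(\<lambda>\<zeta>. g \<zeta> * ennreal (1 - norm \<zeta>)) \<in> borel_measurable \<mu>"
    if [measurable]: "g \<in> borel_measurable borel" for g :: "complex \<Rightarrow> ennreal"
    by (intro m\<mu>) measurable
  from f show ?thesis
  proof (induction rule: borel_measurable_induct)
    case (cong f g)
    have "f = g" using cong by (intro ext) simp
    with cong show ?case by simp
  next
    case (set A)
    then have "A \<inter> space \<psi> \<in> sets \<psi>"
      by (auto simp: \<psi> space_restricted_borel[OF \<psi>] sets_restrict_space)
    then have "(\<integral>\<^sup>+ \<zeta>. indicator A \<zeta> \<partial>\<psi>) = emeasure \<psi> (A \<inter> sphere 0 1)"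
      by (simp add: nn_integral_indicator' space_restricted_borel[OF \<psi>])
    then show ?case
      using set by (simp add: \<Lambda> emeasure)
  next
    case (mult g c)
    then show ?case
      by (simp add: nn_integral_cmult m\<mu> m\<psi> m\<Lambda> weight distrib_left mult.assoc)
  next
    case (add g h)
    have "(\<integral>\<^sup>+ \<zeta>. (g \<zeta> + h \<zeta>) * ennreal (1 - norm \<zeta>) \<partial>\<mu>)
        = (\<integral>\<^sup>+ \<zeta>. g \<zeta> * ennreal (1 - norm \<zeta>) \<partial>\<mu>) + (\<integral>\<^sup>+ \<zeta>. h \<zeta> * ennreal (1 - norm \<zeta>) \<partial>\<mu>)"
      unfolding distrib_right using add by - (rule nn_integral_add; rule weight; assumption)
    with add show ?case
      by (simp add: nn_integral_add m\<psi> m\<Lambda> ac_simps)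
  next
    case (seq U)
    have inc: "incseq (\<lambda>i \<zeta>. U i \<zeta> * ennreal (1 - norm \<zeta>))"
      using seq by (auto simp: incseq_def le_fun_def intro!: mult_right_mono)
    have "(\<integral>\<^sup>+ \<zeta>. (SUP i. U i) \<zeta> \<partial>\<Lambda>) = (SUP i. \<integral>\<^sup>+ \<zeta>. U i \<zeta> \<partial>\<Lambda>)"
      using seq unfolding SUP_apply by (intro nn_integral_monotone_convergence_SUP m\<Lambda>) auto
    also have "\<dots> = (SUP i. (\<integral>\<^sup>+ \<zeta>. U i \<zeta> * ennreal (1 - norm \<zeta>) \<partial>\<mu>) + (\<integral>\<^sup>+ \<zeta>. U i \<zeta> \<partial>\<psi>))"
      using seq by simp
    also have "\<dots> = (SUP i. \<integral>\<^sup>+ \<zeta>. U i \<zeta> * ennreal (1 - norm \<zeta>) \<partial>\<mu>) + (SUP i. \<integral>\<^sup>+ \<zeta>. U i \<zeta> \<partial>\<psi>)"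
      using seq inc by (intro ennreal_SUP_add) (auto simp: incseq_def le_fun_def intro!: nn_integral_mono)
    also have "(SUP i. \<integral>\<^sup>+ \<zeta>. U i \<zeta> * ennreal (1 - norm \<zeta>) \<partial>\<mu>) = (\<integral>\<^sup>+ \<zeta>. (SUP i. U i \<zeta> * ennreal (1 - norm \<zeta>)) \<partial>\<mu>)"
      using seq inc by (intro nn_integral_monotone_convergence_SUP[symmetric] weight) auto
    also have "(SUP i. \<integral>\<^sup>+ \<zeta>. U i \<zeta> \<partial>\<psi>) = (\<integral>\<^sup>+ \<zeta>. (SUP i. U i \<zeta>) \<partial>\<psi>)"
      using seq by (intro nn_integral_monotone_convergence_SUP[symmetric] m\<psi>) auto
    finally show ?case
      by (simp only: SUP_apply SUP_mult_right_ennreal)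
  qed
qed

lemma ereal_integral_nonpos:
  assumes "\<And>x. x \<in> space M \<Longrightarrow> f x \<le> 0"
  shows "ereal_integral M f = - enn2ereal (\<integral>\<^sup>+ x. e2ennreal (- f x) \<partial>M)"
proof -
  have "(\<integral>\<^sup>+ x. e2ennreal (f x) \<partial>M) = (\<integral>\<^sup>+ x. 0 \<partial>M)"
    by (intro nn_integral_cong e2ennreal_neg assms)
  then show ?thesis by (simp add: ereal_integral_def zero_ennreal.rep_eq)
qed

text \<open>The complete measure is pushed forward to the Borel sets of the plane, so that all further
measurability questions concern Borel functions on \<open>\<complex>\<close>; the boxes lie in the closed disc and keep their
measure. The Green potential may be infinite at some points, where \<open>u = -\<infinity>\<close>, while the Poisson integral
is finite at each point of the disc.\<close>

lemma complete_measure_potential: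
  assumes "is_complete_measure u L"
  obtains \<Lambda> C where "finite_measure \<Lambda>" "sets \<Lambda> = sets borel"
    "\<And>\<phi> s. emeasure \<Lambda> (carleson_box \<phi> s) = emeasure L (carleson_box \<phi> s)"
    "\<And>z. z \<in> ball 0 1 \<Longrightarrow> u z = ereal C - enn2ereal (disc_potential \<Lambda> z)"
proof -
  from assms obtain \<mu> \<psi> C where L: "sets L = sets (restrict_space borel (cball 0 1))"
    and rep: "riesz_representation u \<mu> \<psi> C"
    and emeasure_L: "\<And>M. M \<in> sets L \<Longrightarrow> emeasure L M =
           (\<integral>\<^sup>+ \<zeta>\<in>ball 0 1 \<inter> M. ennreal (1 - norm \<zeta>) \<partial>\<mu>) + emeasure \<psi> (M \<inter> sphere 0 1)"
    unfolding is_complete_measure_def by blast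
  from rep have \<mu>: "sets \<mu> = sets (restrict_space borel (ball 0 1))"
    and mass: "(\<integral>\<^sup>+ \<zeta>. ennreal (1 - norm \<zeta>) \<partial>\<mu>) < \<infinity>"
    and \<psi>: "sets \<psi> = sets (restrict_space borel (sphere 0 1))" and fin\<psi>: "finite_measure \<psi>"
    and u: "\<And>z. z \<in> ball 0 1 \<Longrightarrow> u z =
        ereal_integral \<mu> (\<lambda>\<zeta>. elog (norm (z - \<zeta>) / norm (1 - z * cnj \<zeta>)))
        - ereal (1 / (2*pi) * (LINT \<zeta>|\<psi>. (1 - (norm z)\<^sup>2) / (norm (\<zeta> - z))\<^sup>2)) + ereal C"
    unfolding riesz_representation_def is_riesz_measure_def by auto
  interpret \<psi>: finite_measure \<psi> by (rule fin\<psi>)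
  define \<Lambda> where "\<Lambda> = distr L borel (\<lambda>\<zeta>. \<zeta>)"
  have sets_\<Lambda>: "sets \<Lambda> = sets borel" by (simp add: \<Lambda>_def)
  have id: "(\<lambda>\<zeta>. \<zeta>) \<in> measurable L borel"
    by (rule measurable_restricted_borel[OF L]) simp
  have space_L: "space L = cball 0 1" by (rule space_restricted_borel[OF L])
  have \<Lambda>_L: "emeasure \<Lambda> A = emeasure L (A \<inter> cball 0 1)" if "A \<in> sets borel" for A
    using that by (simp add: \<Lambda>_def emeasure_distr[OF id] space_L)
  have \<Lambda>: "emeasure \<Lambda> A = (\<integral>\<^sup>+ \<zeta>. indicator A \<zeta> * ennreal (1 - norm \<zeta>) \<partial>\<mu>) + emeasure \<psi> (A \<inter> sphere 0 1)"
    if A: "A \<in> sets borel" for A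
  proof -
    have "A \<inter> cball 0 1 \<in> sets L"
      using A by (auto simp: L sets_restrict_space)
    then have "emeasure \<Lambda> A = (\<integral>\<^sup>+ \<zeta>\<in>ball 0 1 \<inter> (A \<inter> cball 0 1). ennreal (1 - norm \<zeta>) \<partial>\<mu>)
        + emeasure \<psi> (A \<inter> cball 0 1 \<inter> sphere 0 1)"
      by (simp only: \<Lambda>_L[OF A] emeasure_L)
    also have "A \<inter> cball 0 1 \<inter> sphere 0 1 = A \<inter> sphere 0 (1::real)" by auto
    also have "(\<integral>\<^sup>+ \<zeta>\<in>ball 0 1 \<inter> (A \<inter> cball 0 1). ennreal (1 - norm \<zeta>) \<partial>\<mu>)
        = (\<integral>\<^sup>+ \<zeta>. indicator A \<zeta> * ennreal (1 - norm \<zeta>) \<partial>\<mu>)"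
      by (intro nn_integral_cong) (auto simp: space_restricted_borel[OF \<mu>] indicator_def)
    finally show ?thesis .
  qed
  have "finite_measure \<Lambda>"
  proof
    have "emeasure \<Lambda> UNIV = (\<integral>\<^sup>+ \<zeta>. ennreal (1 - norm \<zeta>) \<partial>\<mu>) + emeasure \<psi> (UNIV \<inter> sphere 0 1)"
      by (subst \<Lambda>) auto
    also have "\<dots> \<noteq> \<infinity>"
      using mass \<psi>.emeasure_finite by (auto simp: less_top[symmetric])
    finally show "emeasure \<Lambda> (space \<Lambda>) \<noteq> \<infinity>"
      using sets_eq_imp_space_eq[OF sets_\<Lambda>] by simp
  qed
  moreover have "emeasure \<Lambda> (carleson_box \<phi> s) = emeasure L (carleson_box \<phi> s)" for \<phi> s
    using carleson_box_subset_cball[of \<phi> s] by (simp add: \<Lambda>_L Int_absorb2)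
  moreover have "u z = ereal C - enn2ereal (disc_potential \<Lambda> z)" if z: "z \<in> ball 0 1" for z
  proof -
    have nz: "norm z < 1" using z by simp
    define G where "G = (\<integral>\<^sup>+ \<zeta>. e2ennreal (- elog (norm (z - \<zeta>) / norm (1 - z * cnj \<zeta>))) \<partial>\<mu>)"
    define P where "P \<zeta> = (1 - (norm z)\<^sup>2) / (norm (\<zeta> - z))\<^sup>2" for \<zeta>
    define I where "I = (LINT \<zeta>|\<psi>. P \<zeta>)"
    have P0: "0 \<le> P \<zeta>" for \<zeta>
      using nz by (simp add: P_def abs_square_le_1)
    have "P \<zeta> \<le> 1 / (1 - norm z)\<^sup>2" if "\<zeta> \<in> space \<psi>" for \<zeta>
    proof -
      have "norm \<zeta> = 1" using that by (simp add: space_restricted_borel[OF \<psi>])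
      then have "1 - norm z \<le> norm (\<zeta> - z)" using norm_triangle_ineq2[of \<zeta> z] by simp
      then have "(1 - norm z)\<^sup>2 \<le> (norm (\<zeta> - z))\<^sup>2" using nz by (intro power_mono) auto
      then show ?thesis unfolding P_def using nz by (intro frac_le) auto
    qed
    moreover have "P \<in> borel_measurable \<psi>"
      unfolding P_def by (rule measurable_restricted_borel[OF \<psi>]) measurable
    ultimately have int_P: "integrable \<psi> P"
      using P0 by (intro \<psi>.integrable_const_bound[where B = "1 / (1 - norm z)\<^sup>2"]) auto
    have I0: "0 \<le> I" unfolding I_def using P0 by (intro integral_nonneg_AE) auto
    have "ereal_integral \<mu> (\<lambda>\<zeta>. elog (norm (z - \<zeta>) / norm (1 - z * cnj \<zeta>))) = - enn2ereal G"
      unfolding G_def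
    proof (rule ereal_integral_nonpos)
      fix \<zeta> assume "\<zeta> \<in> space \<mu>"
      then have \<zeta>: "norm \<zeta> < 1" by (simp add: space_restricted_borel[OF \<mu>])
      then have "(norm (z - \<zeta>))\<^sup>2 \<le> (norm (1 - z * cnj \<zeta>))\<^sup>2"
        using nz by (subst norm_one_minus_mult_cnj_sq) (auto simp: abs_square_le_1)
      then have "norm (z - \<zeta>) / norm (1 - z * cnj \<zeta>) \<le> 1"
        using one_minus_mult_cnj_nonzero[of z \<zeta>] nz \<zeta> by (simp add: power2_le_iff_abs_le)
      then show "elog (norm (z - \<zeta>) / norm (1 - z * cnj \<zeta>)) \<le> 0"
        by (auto simp: elog_def simp del: divide_le_0_iff divide_le_eq_1)
    qed
    then have uz: "u z = - enn2ereal G - ereal (1 / (2*pi) * I) + ereal C"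
      using u[OF z] by (simp add: I_def P_def)
    have "disc_potential \<Lambda> z = (\<integral>\<^sup>+ \<zeta>. disc_kernel z \<zeta> * ennreal (1 - norm \<zeta>) \<partial>\<mu>) + (\<integral>\<^sup>+ \<zeta>. disc_kernel z \<zeta> \<partial>\<psi>)"
      unfolding disc_potential_def
    proof (rule nn_integral_complete_measure[OF \<mu> \<psi> sets_\<Lambda> \<Lambda>])
      show "disc_kernel z \<in> borel_measurable borel"
        by (rule borel_measurable_disc_kernel[of "\<lambda>_. z" borel "\<lambda>\<zeta>. \<zeta>"]) auto
    qed
    also have "(\<integral>\<^sup>+ \<zeta>. disc_kernel z \<zeta> * ennreal (1 - norm \<zeta>) \<partial>\<mu>) = G"
      unfolding G_def
    proof (intro nn_integral_cong)
      fix \<zeta> assume "\<zeta> \<in> space \<mu>"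
      then have \<zeta>: "norm \<zeta> < 1" by (simp add: space_restricted_borel[OF \<mu>])
      have cancel: "a / ennreal (1 - norm \<zeta>) * ennreal (1 - norm \<zeta>) = a" for a
        proof (cases a)
        case (real x)
        then have "a / ennreal (1 - norm \<zeta>) * ennreal (1 - norm \<zeta>) = ennreal (x / (1 - norm \<zeta>)) * ennreal (1 - norm \<zeta>)"
          using \<zeta> by (simp add: divide_ennreal)
        also have "\<dots> = ennreal (x / (1 - norm \<zeta>) * (1 - norm \<zeta>))"
          using \<zeta> real by (intro ennreal_mult[symmetric]) auto
        also have "x / (1 - norm \<zeta>) * (1 - norm \<zeta>) = x"
          using \<zeta> by simp
        finally show ?thesis using real by simp
      next
        case top
        then show ?thesis using \<zeta> by (simp add: ennreal_top_divide ennreal_top_mult)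
      qed
      show "disc_kernel z \<zeta> * ennreal (1 - norm \<zeta>) = e2ennreal (- elog (norm (z - \<zeta>) / norm (1 - z * cnj \<zeta>)))"
        using \<zeta> by (simp add: disc_kernel_def cancel)
    qed
    also have "(\<integral>\<^sup>+ \<zeta>. disc_kernel z \<zeta> \<partial>\<psi>) = (\<integral>\<^sup>+ \<zeta>. ennreal (1 / (2*pi) * P \<zeta>) \<partial>\<psi>)"
      by (intro nn_integral_cong) (auto simp: space_restricted_borel[OF \<psi>] disc_kernel_def P_def)
    also have "\<dots> = ennreal (1 / (2*pi) * I)"
      unfolding I_def using int_P P0 by (subst nn_integral_eq_integral) auto
    finally have pot: "disc_potential \<Lambda> z = G + ennreal (1 / (2*pi) * I)" .
    show ?thesis
      using I0 unfolding uz pot by (cases G) (auto simp: plus_ennreal.rep_eq enn2ereal_ennreal)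
  qed
  ultimately show ?thesis using that sets_\<Lambda> by blast
qed

section \<open>The growth of the means of a subharmonic function\<close>

lemma nn_integral_powr_le_add_const:
  assumes [measurable]: "f \<in> borel_measurable borel" and p: "0 \<le> p" and c: "0 \<le> c"
    and le: "\<And>t. g t \<le> f t + ennreal c"
  shows "(\<integral>\<^sup>+ t\<in>{0..2*pi}. ennreal_powr (g t) p \<partial>lborel)
    \<le> ennreal (2 powr p) * ((\<integral>\<^sup>+ t\<in>{0..2*pi}. ennreal_powr (f t) p \<partial>lborel) + ennreal (2 * pi * c powr p))"
proof -
  have "(\<integral>\<^sup>+ t\<in>{0..2*pi}. ennreal_powr (g t) p \<partial>lborel)
      \<le> (\<integral>\<^sup>+ t. ennreal (2 powr p) * (ennreal_powr (f t) p * indicator {0..2*pi} t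
          + ennreal (c powr p) * indicator {0..2*pi} t) \<partial>lborel)"
  proof (intro nn_integral_mono)
    fix t
    have "ennreal_powr (g t) p \<le> ennreal_powr (f t + ennreal c) p"
      by (intro ennreal_powr_mono le p)
    also have "\<dots> \<le> ennreal (2 powr p) * (ennreal_powr (f t) p + ennreal_powr (ennreal c) p)"
      by (rule ennreal_powr_add_le[OF p])
    finally show "ennreal_powr (g t) p * indicator {0..2*pi} t \<le> ennreal (2 powr p) *
        (ennreal_powr (f t) p * indicator {0..2*pi} t + ennreal (c powr p) * indicator {0..2*pi} t)"
      using c by (auto simp: indicator_def ennreal_powr_ennreal)
  qed
  also have "\<dots> = ennreal (2 powr p) * ((\<integral>\<^sup>+ t\<in>{0..2*pi}. ennreal_powr (f t) p \<partial>lborel)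
      + (\<integral>\<^sup>+ t. ennreal (c powr p) * indicator {0..2*pi} t \<partial>lborel))"
    by (simp add: nn_integral_cmult nn_integral_add)
  also have "(\<integral>\<^sup>+ t. ennreal (c powr p) * indicator {0..2*pi} t \<partial>lborel) = ennreal (c powr p) * ennreal (2 * pi)"
    by (subst nn_integral_cmult_indicator) auto
  also have "\<dots> = ennreal (2 * pi * c powr p)"
    by (simp add: mult.commute flip: ennreal_mult)
  finally show ?thesis .
qed

text \<open>As \<open>\<delta> \<le> 1\<close> and \<open>q \<le> 0\<close>, a constant is at most a multiple of \<open>\<delta>\<^sup>q\<close>. This is where \<open>\<gamma> \<le> 1\<close> makes the
constant \<open>C\<close> of the representation harmless.\<close>

lemma power_growth_add_const:
  fixes X Y :: "real \<Rightarrow> ennreal"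
  assumes q: "q \<le> 0" and c: "0 \<le> c" "0 \<le> b" and M: "0 \<le> M" "0 < \<eta>"
    and X: "\<And>\<delta>. 0 < \<delta> \<Longrightarrow> \<delta> < \<eta> \<Longrightarrow> X \<delta> \<le> ennreal (M * \<delta> powr q)"
    and Y: "\<And>\<delta>. 0 < \<delta> \<Longrightarrow> \<delta> < 1 \<Longrightarrow> Y \<delta> \<le> ennreal b * (X \<delta> + ennreal c)"
  shows "\<exists>M\<ge>0. \<exists>\<eta>>0. \<forall>\<delta>\<in>{0<..<\<eta>}. Y \<delta> \<le> ennreal (M * \<delta> powr q)"
proof -
  have "Y \<delta> \<le> ennreal (b * (M + c) * \<delta> powr q)" if \<delta>: "0 < \<delta>" "\<delta> < min \<eta> 1" for \<delta>
  proof -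
    have one: "1 \<le> \<delta> powr q"
    proof -
      have "\<delta> powr 0 \<le> \<delta> powr q" using \<delta> q by (intro powr_mono') auto
      then show ?thesis using \<delta> by simp
    qed
    have "Y \<delta> \<le> ennreal b * (X \<delta> + ennreal c)" using \<delta> by (intro Y) auto
    also have "\<dots> \<le> ennreal b * (ennreal (M * \<delta> powr q) + ennreal c)"
      using \<delta> by (intro mult_left_mono add_right_mono X) auto
    also have "\<dots> = ennreal (b * (M * \<delta> powr q + c))"
      using c M by (simp flip: ennreal_plus ennreal_mult)
    also have "\<dots> \<le> ennreal (b * (M * \<delta> powr q + c * \<delta> powr q))"
      using c one mult_left_mono[OF one, of c] by (intro ennreal_leI mult_left_mono add_left_mono) auto
    also have "b * (M * \<delta> powr q + c * \<delta> powr q) = b * (M + c) * \<delta> powr q"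
      by (simp add: algebra_simps)
    finally show ?thesis .
  qed
  then show ?thesis
    using c M by (intro exI[of _ "b * (M + c)"] conjI exI[of _ "min \<eta> 1"]) auto
qed

text \<open>Taking \<open>p\<close>-th powers on both sides. A negative \<open>K\<close> makes the right-hand side of the bound zero, and
\<open>max K 0\<close> is the nonnegative constant with the same effect.\<close>

lemma root_growth_iff:
  assumes p: "0 < p" and a: "0 < a"
  shows "ennreal_powr (ennreal a * X) (1 / p) \<le> ennreal (K * s powr q) \<longleftrightarrow>
      X \<le> ennreal ((max K 0) powr p / a * s powr (q * p))"
proof -
  have "ennreal (K * s powr q) = ennreal (max K 0 * s powr q)"
    by (auto simp: max_def ennreal_neg mult_nonpos_nonneg)
  then have "ennreal_powr (ennreal a * X) (1 / p) \<le> ennreal (K * s powr q)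
      \<longleftrightarrow> ennreal a * X \<le> ennreal ((max K 0 * s powr q) powr p)"
    using ennreal_powr_inverse_le_iff[OF p, of "max K 0 * s powr q"] by simp
  also have "(max K 0 * s powr q) powr p = a * (max K 0 powr p / a * s powr (q * p))"
    using a by (simp add: powr_mult powr_powr)
  also have "ennreal \<dots> = ennreal a * ennreal (max K 0 powr p / a * s powr (q * p))"
    using a by (intro ennreal_mult) auto
  also have "ennreal a * X \<le> \<dots> \<longleftrightarrow> X \<le> ennreal (max K 0 powr p / a * s powr (q * p))"
    using a by (intro ennreal_mult_le_mult_iff) auto
  finally show ?thesis .
qed

theorem theorem1:
  fixes u :: "complex \<Rightarrow> ereal" and \<gamma> p :: real and L :: "complex measure"
  assumes "subharmonic_on (ball 0 1) u"
    and "\<exists>B::real. \<forall>z\<in>ball 0 1. u z \<le> ereal B"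
    and "0 < \<gamma>" and "\<gamma> \<le> 1" and "1 < p"
    and "is_complete_measure u L"
  shows "(\<exists>K::real. \<forall>\<^sub>F r in at_left 1. p_mean p r u \<le> ennreal (K * (1 - r) powr (\<gamma> - 1)))
    \<longleftrightarrow> (\<exists>K::real. \<forall>\<delta>\<in>{0<..<1}. carleson_norm p L \<delta> \<le> ennreal (K * \<delta> powr \<gamma>))"
proof -
  from complete_measure_potential[OF assms(6)] obtain \<Lambda> C
    where fin: "finite_measure \<Lambda>" and sets: "sets \<Lambda> = sets borel"
      and boxes: "\<And>\<phi> s. emeasure \<Lambda> (carleson_box \<phi> s) = emeasure L (carleson_box \<phi> s)"
      and u: "\<And>z. z \<in> ball 0 1 \<Longrightarrow> u z = ereal C - enn2ereal (disc_potential \<Lambda> z)"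
    by blast
  note p = \<open>1 < p\<close>
  define q where "q = (\<gamma> - 1) * p"
  have q: "q \<le> 0" using p \<open>\<gamma> \<le> 1\<close> by (simp add: q_def mult_nonpos_nonneg)
  define U where "U \<delta> = (\<integral>\<^sup>+ t\<in>{0..2*pi}. ennreal_powr (e2ennreal \<bar>u (of_real (1 - \<delta>) * cis t)\<bar>) p \<partial>lborel)" for \<delta>
  define c where "c = 2 * pi * \<bar>C\<bar> powr p"

  have U_eq: "p_mean p (1 - \<delta>) u = ennreal_powr (ennreal (1 / (2*pi)) * U \<delta>) (1 / p)" for \<delta>
    by (simp only: p_mean_def U_def)
  \<comment> \<open>Passing between \<open>|u| = |C - V|\<close> and \<open>V\<close> costs at most \<open>|C|\<close> in either direction.\<close>
  have compare: "U \<delta> \<le> ennreal (2 powr p) * (circle_energy p \<Lambda> \<delta> + ennreal c)"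
      "circle_energy p \<Lambda> \<delta> \<le> ennreal (2 powr p) * (U \<delta> + ennreal c)" if \<delta>: "0 < \<delta>" "\<delta> < 1" for \<delta>
  proof -
    define v where "v t = disc_potential \<Lambda> (of_real (1 - \<delta>) * cis t)" for t
    have [measurable]: "v \<in> borel_measurable borel"
      unfolding v_def by (intro borel_measurable_disc_potential[OF fin sets]) measurable
    have "u (of_real (1 - \<delta>) * cis t) = ereal C - enn2ereal (v t)" for t
      unfolding v_def using \<delta> norm_circle_point[of \<delta> t] by (intro u) simp
    then have w: "U \<delta> = (\<integral>\<^sup>+ t\<in>{0..2*pi}. ennreal_powr (e2ennreal \<bar>ereal C - enn2ereal (v t)\<bar>) p \<partial>lborel)"
      by (simp only: U_def)
    have w_le: "e2ennreal \<bar>ereal C - enn2ereal (v t)\<bar> \<le> v t + ennreal \<bar>C\<bar>" for t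
      by (cases "v t") (auto simp: enn2ereal_ennreal simp flip: ennreal_plus intro!: ennreal_leI)
    have v_le: "v t \<le> e2ennreal \<bar>ereal C - enn2ereal (v t)\<bar> + ennreal \<bar>C\<bar>" for t
      by (cases "v t") (auto simp: enn2ereal_ennreal simp flip: ennreal_plus intro!: ennreal_leI)
    show "U \<delta> \<le> ennreal (2 powr p) * (circle_energy p \<Lambda> \<delta> + ennreal c)"
      unfolding w circle_energy_def c_def v_def[symmetric]
      using p by (intro nn_integral_powr_le_add_const w_le) auto
    show "circle_energy p \<Lambda> \<delta> \<le> ennreal (2 powr p) * (U \<delta> + ennreal c)"
      unfolding w circle_energy_def c_def v_def[symmetric]
      using p by (intro nn_integral_powr_le_add_const v_le) auto
  qed

  have "(\<exists>K::real. \<forall>\<^sub>F r in at_left 1. p_mean p r u \<le> ennreal (K * (1 - r) powr (\<gamma> - 1)))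
      \<longleftrightarrow> (\<exists>M\<ge>0. \<exists>\<eta>>0. \<forall>\<delta>\<in>{0<..<\<eta>}. U \<delta> \<le> ennreal (M * \<delta> powr q))" (is "?mean \<longleftrightarrow> ?U")
  proof
    assume ?mean
    then obtain K b where b: "b < 1"
      and K: "\<And>r. b < r \<Longrightarrow> r < 1 \<Longrightarrow> p_mean p r u \<le> ennreal (K * (1 - r) powr (\<gamma> - 1))"
      unfolding eventually_at_left_field by blast
    have "U \<delta> \<le> ennreal (max K 0 powr p / (1 / (2*pi)) * \<delta> powr q)" if "0 < \<delta>" "\<delta> < 1 - b" for \<delta>
      using K[of "1 - \<delta>"] that p unfolding U_eq q_def
      by (subst root_growth_iff[symmetric]) auto
    then show ?U
      using b by (intro exI[of _ "max K 0 powr p / (1 / (2*pi))"] conjI exI[of _ "1 - b"]) auto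
  next
    assume ?U
    then obtain M \<eta> where M: "0 \<le> M" and \<eta>: "0 < \<eta>" and U: "\<And>\<delta>. 0 < \<delta> \<Longrightarrow> \<delta> < \<eta> \<Longrightarrow> U \<delta> \<le> ennreal (M * \<delta> powr q)"
      by auto
    define K where "K = (M * (1 / (2*pi))) powr (1 / p)"
    have K: "max K 0 powr p / (1 / (2*pi)) = M"
      using M p by (simp add: K_def powr_powr)
    have "p_mean p r u \<le> ennreal (K * (1 - r) powr (\<gamma> - 1))" if "1 - \<eta> < r" "r < 1" for r
    proof -
      have "p_mean p (1 - (1 - r)) u \<le> ennreal (K * (1 - r) powr (\<gamma> - 1))"
        unfolding U_eq using p U[of "1 - r"] that K
        by (subst root_growth_iff) (auto simp: q_def)
      then show ?thesis by simp
    qed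
    then show ?mean
      unfolding eventually_at_left_field using \<eta> by (intro exI[of _ K] exI[of _ "1 - \<eta>"]) auto
  qed
  also have "\<dots> \<longleftrightarrow> (\<exists>M\<ge>0. \<exists>\<eta>>0. \<forall>\<delta>\<in>{0<..<\<eta>}. circle_energy p \<Lambda> \<delta> \<le> ennreal (M * \<delta> powr q))"
  proof -
    have c: "0 \<le> c" by (simp add: c_def)
    show ?thesis
      using compare power_growth_add_const[OF q c, of "2 powr p" _ _ U "circle_energy p \<Lambda>"]
        power_growth_add_const[OF q c, of "2 powr p" _ _ "circle_energy p \<Lambda>" U]
      by (auto simp: greaterThanLessThan_iff)
  qed
  also have "\<dots> \<longleftrightarrow> (\<exists>M\<ge>0. \<forall>\<delta>>0. box_energy p \<Lambda> \<delta> \<le> ennreal (M * \<delta> powr (\<gamma> * p)))"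
    unfolding q_def by (rule circle_energy_growth_iff_box_energy_growth[OF fin sets p \<open>0 < \<gamma>\<close> \<open>\<gamma> \<le> 1\<close>])
  also have "\<dots> \<longleftrightarrow> (\<exists>K::real. \<forall>\<delta>\<in>{0<..<1}. carleson_norm p L \<delta> \<le> ennreal (K * \<delta> powr \<gamma>))" (is "?box \<longleftrightarrow> ?norm")
  proof -
    have norm_iff: "carleson_norm p L \<delta> \<le> ennreal (K * \<delta> powr \<gamma>)
        \<longleftrightarrow> box_energy p \<Lambda> \<delta> \<le> ennreal (max K 0 powr p * \<delta> powr (\<gamma> * p))" for K \<delta>
      using root_growth_iff[of p 1 "box_energy p \<Lambda> \<delta>" K \<delta> \<gamma>] p
      by (simp add: carleson_norm_def box_energy_def boxes)
    show ?thesis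
    proof
      assume ?box
      then obtain M where M: "0 \<le> M" "\<And>\<delta>. 0 < \<delta> \<Longrightarrow> box_energy p \<Lambda> \<delta> \<le> ennreal (M * \<delta> powr (\<gamma> * p))"
        by auto
      have "max (M powr (1 / p)) 0 powr p = M"
        using M p by (simp add: powr_powr)
      then show ?norm
        unfolding norm_iff using M by (intro exI[of _ "M powr (1 / p)"]) auto
    next
      assume ?norm
      then obtain K where "\<And>\<delta>. 0 < \<delta> \<Longrightarrow> \<delta> < 1 \<Longrightarrow> box_energy p \<Lambda> \<delta> \<le> ennreal (max K 0 powr p * \<delta> powr (\<gamma> * p))"
        unfolding norm_iff by (metis greaterThanLessThan_iff)
      then show ?box
        using p \<open>0 < \<gamma>\<close> by (intro box_energy_extend[OF fin sets, where \<eta> = 1 and M = "max K 0 powr p"]) auto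
    qed
  qed
  finally show ?thesis .
qed

end
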